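(* Let $\mathcal{A}=\mathcal{A}_s+\mathcal{A}_d\epsilon$ be a dual tensor of order $m$ and dimension $n$ ($m\ge 2$), where $\mathcal{A}_s$ is a weakly irreducible nonnegative tensor. Then $\mathcal{A}$ has a positive dual number eigenvalue $\lambda=\lambda_s+\lambda_d\epsilon$ with a positive dual eigenvector $x=x_s+x_d\epsilon$. Furthermore, $\lambda_s,\lambda_d,x_s,x_d$ have the following properties, where $$M=(m-1)\lambda_s\,({\rm diag}((x_s)_1,\ldots,(x_s)_n))^{m-2}-\sum_{k=2}^m A^{(k)}$$ and $A^{(k)}$ is the $n\times n$ matrix with entries, for $1\le i,j\le n$, $$(A^{(k)})_{ij}=\sum_{i_2,\ldots,i_{k-1},i_{k+1},\ldots,i_m=1}^n(\mathcal{A}_s)_{ii_2\cdots i_{k-1}ji_{k+1}\cdots i_m}(x_s)_{i_2}\cdots (x_s)_{i_{k-1}}(x_s)_{i_{k+1}}\cdots(x_s)_{i_m}.$$ (1) $\lambda_s$ is the spectral radius of $\mathcal{A}_s$ and $\mathcal{A}_sx_s^{m-1}=\lambda_sx_s^{[m-1]}$. (2) The matrix $M$ is an irreducible singular $M$-matrix such that $${\rm Ker}(M)=\{cx_s:c\in\mathbb{R}\},\qquad \lambda_d=\frac{y^\top(\mathcal{A}_dx_s^{m-1})}{y^\top x_s^{[m-1]}},$$ where $y$ is the unique positive unit vector such that $y^\top M=0$. Moreover, if $\mathcal{A}_s$ is symmetric, then $y=(x_s^\top x_s)^{-1/2}x_s$. (3) Let $M^{(1)}$ be a $\{1\}$-inverse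 of $M$. Then $$x_d\in S=\{M^{(1)}(\mathcal{A}_d-\lambda_d\mathcal{I})x_s^{m-1}+cx_s:c\in\mathbb{R}\},$$ and for any $z\in S$, $x_s+z\epsilon$ is an eigenvector of the eigenvalue $\lambda$ of $\mathcal{A}$. (4) If $x_s^\top x_d=0$, then $x_d=M^\#(\mathcal{A}_d-\lambda_d\mathcal{I})x_s^{m-1}$.
   Context: Dual numbers: $\mathbb{D}=\{a_s+a_d\epsilon: a_s,a_d\in\mathbb{R}\}$ with $\epsilon\ne0$, $\epsilon^2=0$, $\epsilon$ commuting with reals; $a_s,a_d$ are the standard and dual parts. A dual vector is $x=x_s+x_d\epsilon$ with $x_s,x_d\in\mathbb{R}^n$; a dual tensor of order $m$ and dimension $n$ is $\mathcal{A}=\mathcal{A}_s+\mathcal{A}_d\epsilon$ with $\mathcal{A}_s,\mathcal{A}_d$ real $n\times\cdots\times n$ ($m$ indices) arrays. A dual number $\lambda$ is positive if $\lambda_s>0$; a dual vector $x$ is positive if all entries of $x_s$ are positive. For a (real, complex or dual) tensor $\mathcal{A}=(a_{i_1\cdots i_m})$ and vector $x$, $\mathcal{A}x^{m-1}$ is the vector with $i$-th entry $\sum_{i_2,\ldots,i_m=1}^n a_{ii_2\cdots i_m}x_{i_2}\cdots x_{i_m}$, and $x^{[m-1]}=(x_1^{m-1},\ldots,x_n^{m-1})^\top$. A dual number $\lambda$ is an eigenvalue of the dual tensor $\mathcal{A}$ with eigenvector $x=x_s+x_d\epsilon\in\mathbb{D}^n$ if $x_s\neq0$ and $\mathcal{A}x^{m-1}=\lambda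 x^{[m-1]}$. For a complex tensor, eigenvalues are those $\lambda\in\mathbb{C}$ for which $\mathcal{A}x^{m-1}=\lambda x^{[m-1]}$ for some nonzero $x\in\mathbb{C}^n$; the spectral radius is the largest modulus of an eigenvalue. $\mathcal{I}$ is the diagonal tensor of order $m$ and dimension $n$ with all diagonal entries $1$ (so $\mathcal{I}x^{m-1}=x^{[m-1]}$). A tensor is symmetric if its entries are invariant under all permutations of the indices. A tensor $\mathcal{A}$ is weakly irreducible if the digraph with vertex set $\{1,\ldots,n\}$ and arcs $(i,j)$ whenever $a_{ii_2\cdots i_m}\ne0$ for some $(i_2,\ldots,i_m)$ with $j\in\{i_2,\ldots,i_m\}\neq\{i\}$ is strongly connected; the zero tensor of dimension $1$ is not regarded as weakly irreducible. A $Z$-matrix is a real square matrix with nonpositive off-diagonal entries; an $M$-matrix is a $Z$-matrix of the form $sI-B$ with $B$ entrywise nonnegative and $s\ge\rho(B)$ ($\rho$ the spectral radius). A square matrix is irreducible if the digraph of its nonzero off-diagonal entries is strongly connected ($1\times1$ matrices are irreducible). ${\rm Ker}(M)=\{v\in\mathbb{R}^n:Mv=0\}$. A $\{1\}$-inverse of $M$ is any real matrix $X$ with $MXM=M$. The group inverse $M^\#$ is the unique matrix $X$ with $MXM=M$, $XMX=X$, $MX=XM$ (it exists iff ${\rm rank}(M)={\rm rank}(M^2)$). "Unit vector" means Euclidean norm $1$; the zeroth power of a diagonal matrix is the identity.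
   Formalization: Item (4) as printed fails for some positive eigenpairs when y is not parallel to x_s; for every positive eigenpair it is proved with y^T x_d = 0 in place of x_s^T x_d = 0, and with the printed hypothesis only for the eigenpair whose existence is asserted. *)

theory Defs
  imports "HOL-Analysis.Analysis" "HOL-Combinatorics.Permutations"
begin

datatype dual_num = Dual (std_part: real) (eps_part: real)

instantiation dual_num :: comm_ring_1
begin

definition "0 = Dual 0 0"
definition "1 = Dual 1 0"
definition "a + b = Dual (std_part a + std_part b) (eps_part a + eps_part b)"
definition "a - b = Dual (std_part a - std_part b) (eps_part a - eps_part b)"
definition "- a = Dual (- std_part a) (- eps_part a)"
definition "a * b = Dual (std_part a * std_part b)
                         (std_part a * eps_part b + eps_part a * std_part b)"

instance
  by intro_classes
    (simp_all add: zero_dual_num_def one_dual_num_def plus_dual_num_def minus_dual_num_def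
      uminus_dual_num_def times_dual_num_def algebra_simps)

end

definition dual_eps :: dual_num where
  "dual_eps = Dual 0 1"

lemma dual_eps_square: "dual_eps * dual_eps = 0"
  by (simp add: dual_eps_def times_dual_num_def zero_dual_num_def)

lemma Dual_eq: "Dual a b = Dual a 0 + Dual b 0 * dual_eps"
  by (simp add: dual_eps_def times_dual_num_def plus_dual_num_def)

definition dual_pos :: "dual_num \<Rightarrow> bool" where
  "dual_pos a \<longleftrightarrow> std_part a > 0"

definition dual_vec :: "real^'n \<Rightarrow> real^'n \<Rightarrow> dual_num^'n" where
  "dual_vec u v = (\<chi> i. Dual (u $ i) (v $ i))"

definition std_vec :: "dual_num^'n \<Rightarrow> real^'n" where
  "std_vec x = (\<chi> i. std_part (x $ i))"

definition eps_vec :: "dual_num^'n \<Rightarrow> real^'n" where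
  "eps_vec x = (\<chi> i. eps_part (x $ i))"

definition pos_vec :: "real^'n \<Rightarrow> bool" where
  "pos_vec v \<longleftrightarrow> (\<forall>i. v $ i > 0)"

definition dual_pos_vec :: "dual_num^'n \<Rightarrow> bool" where
  "dual_pos_vec x \<longleftrightarrow> pos_vec (std_vec x)"

text \<open>A tensor of order \<open>m\<close> and dimension \<open>CARD('n)\<close> is a function on index lists. Only its
  values at lists of length \<open>m\<close> are entries; every notion below takes \<open>m\<close> as an argument and
  ignores the other values.\<close>
type_synonym ('a, 'n) tensor = "'n list \<Rightarrow> 'a"

definition tensor_apply ::
    "nat \<Rightarrow> ('a::comm_semiring_1, 'n::finite) tensor \<Rightarrow> 'a^'n \<Rightarrow> 'a^'n" where
  "tensor_apply m A x =
     (\<chi> i. \<Sum>js | length js = m - 1. A (i # js) * (\<Prod>j\<leftarrow>js. x $ j))"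

definition vec_power :: "'a::comm_semiring_1^'n \<Rightarrow> nat \<Rightarrow> 'a^'n" where
  "vec_power x k = (\<chi> i. x $ i ^ k)"

definition id_tensor :: "nat \<Rightarrow> ('a::comm_semiring_1, 'n) tensor" where
  "id_tensor m is = (if \<exists>i. is = replicate m i then 1 else 0)"

definition nonneg_tensor :: "nat \<Rightarrow> (real, 'n) tensor \<Rightarrow> bool" where
  "nonneg_tensor m A \<longleftrightarrow> (\<forall>is. length is = m \<longrightarrow> A is \<ge> 0)"

definition symmetric_tensor :: "nat \<Rightarrow> ('a, 'n) tensor \<Rightarrow> bool" where
  "symmetric_tensor m A \<longleftrightarrow>
     (\<forall>is p. length is = m \<and> p permutes {..<m} \<longrightarrow> A (permute_list p is) = A is)"

definition strongly_connected :: "('n \<times> 'n) set \<Rightarrow> bool" where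
  "strongly_connected E \<longleftrightarrow> (\<forall>i j. (i, j) \<in> E\<^sup>*)"

definition tensor_arcs :: "nat \<Rightarrow> ('a::zero, 'n) tensor \<Rightarrow> ('n \<times> 'n) set" where
  "tensor_arcs m A =
     {(i, j). \<exists>js. length js = m - 1 \<and> A (i # js) \<noteq> 0 \<and> j \<in> set js \<and> set js \<noteq> {i}}"

text \<open>In dimension 1 the digraph is always strongly connected, so the zero tensor is excluded
  explicitly.\<close>
definition weakly_irreducible :: "nat \<Rightarrow> ('a::zero, 'n::finite) tensor \<Rightarrow> bool" where
  "weakly_irreducible m A \<longleftrightarrow> strongly_connected (tensor_arcs m A) \<and>
     \<not> (CARD('n) = 1 \<and> (\<forall>is. length is = m \<longrightarrow> A is = 0))"

definition dual_eigenpair ::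
    "nat \<Rightarrow> (dual_num, 'n::finite) tensor \<Rightarrow> dual_num \<Rightarrow> dual_num^'n \<Rightarrow> bool" where
  "dual_eigenpair m A l x \<longleftrightarrow>
     std_vec x \<noteq> 0 \<and> tensor_apply m A x = l *s vec_power x (m - 1)"

definition tensor_eigenvalues :: "nat \<Rightarrow> (complex, 'n::finite) tensor \<Rightarrow> complex set" where
  "tensor_eigenvalues m A =
     {l. \<exists>x. x \<noteq> 0 \<and> tensor_apply m A x = l *s vec_power x (m - 1)}"

text \<open>\<open>r\<close> is the largest modulus occurring in the set \<open>S\<close> of eigenvalues; in particular it is
  attained, which a definition through \<open>Sup\<close> would not guarantee.\<close>
definition is_spectral_radius :: "complex set \<Rightarrow> real \<Rightarrow> bool" where
  "is_spectral_radius S r \<longleftrightarrow> r \<in> cmod ` S \<and> (\<forall>l\<in>S. cmod l \<le> r)"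

definition matrix_eigenvalues :: "complex^'n^'n \<Rightarrow> complex set" where
  "matrix_eigenvalues B = {l. \<exists>v. v \<noteq> 0 \<and> B *v v = l *s v}"

definition complex_matrix :: "real^'n^'n \<Rightarrow> complex^'n^'n" where
  "complex_matrix B = (\<chi> i j. complex_of_real (B $ i $ j))"

definition Z_matrix :: "real^'n^'n \<Rightarrow> bool" where
  "Z_matrix M \<longleftrightarrow> (\<forall>i j. i \<noteq> j \<longrightarrow> M $ i $ j \<le> 0)"

definition M_matrix :: "real^'n^'n \<Rightarrow> bool" where
  "M_matrix M \<longleftrightarrow> Z_matrix M \<and>
     (\<exists>s B r. M = mat s - B \<and> (\<forall>i j. B $ i $ j \<ge> 0) \<and>
        is_spectral_radius (matrix_eigenvalues (complex_matrix B)) r \<and> s \<ge> r)"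

definition irreducible_matrix :: "real^'n^'n \<Rightarrow> bool" where
  "irreducible_matrix M \<longleftrightarrow> strongly_connected {(i, j). i \<noteq> j \<and> M $ i $ j \<noteq> 0}"

definition matrix_ker :: "real^'n^'n \<Rightarrow> (real^'n) set" where
  "matrix_ker M = {v. M *v v = 0}"

definition is_one_inverse :: "real^'n^'n \<Rightarrow> real^'n^'n \<Rightarrow> bool" where
  "is_one_inverse M X \<longleftrightarrow> M ** X ** M = M"

definition is_group_inverse :: "real^'n^'n \<Rightarrow> real^'n^'n \<Rightarrow> bool" where
  "is_group_inverse M X \<longleftrightarrow> M ** X ** M = M \<and> X ** M ** X = X \<and> M ** X = X ** M"

definition diag_matrix :: "real^'n \<Rightarrow> real^'n^'n" where
  "diag_matrix v = (\<chi> i j. if i = j then v $ i else 0)"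

text \<open>The library's \<open>^\<close> on \<^typ>\<open>real^'n^'n\<close> is the entrywise power, not the power for \<open>**\<close>.\<close>
definition matrix_power :: "real^'n^'n \<Rightarrow> nat \<Rightarrow> real^'n^'n" where
  "matrix_power D k = (((**) D) ^^ k) (mat 1)"

text \<open>The matrix \<open>A\<^sup>(\<^sup>k\<^sup>)\<close>, for \<open>2 \<le> k \<le> m\<close>: the list \<open>js\<close> of length \<open>m - 2\<close> holds
  \<open>i\<^sub>2, \<dots>, i\<^sub>k\<^sub>-\<^sub>1, i\<^sub>k\<^sub>+\<^sub>1, \<dots>, i\<^sub>m\<close>, and \<open>j\<close> is inserted as the \<open>k\<close>-th index of the entry.\<close>
definition partial_matrix ::
    "nat \<Rightarrow> (real, 'n::finite) tensor \<Rightarrow> real^'n \<Rightarrow> nat \<Rightarrow> real^'n^'n" where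
  "partial_matrix m A x k =
     (\<chi> i j. \<Sum>js | length js = m - 2.
        A (i # take (k - 2) js @ j # drop (k - 2) js) * (\<Prod>p\<leftarrow>js. x $ p))"

definition perron_matrix ::
    "nat \<Rightarrow> (real, 'n::finite) tensor \<Rightarrow> real \<Rightarrow> real^'n \<Rightarrow> real^'n^'n" where
  "perron_matrix m A l x =
     (real (m - 1) * l) *\<^sub>R matrix_power (diag_matrix x) (m - 2)
       - (\<Sum>k = 2..m. partial_matrix m A x k)"

definition pos_unit_left_null :: "real^'n^'n \<Rightarrow> real^'n \<Rightarrow> bool" where
  "pos_unit_left_null M y \<longleftrightarrow> pos_vec y \<and> norm y = 1 \<and> y v* M = 0"

end

theory Submission
  imports Defs
begin

text \<open>A positive eigenvector of \<open>A\<^sub>s\<close> is found by minimising, over positive \<open>x\<close>, the least \<open>t\<close> with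
  \<open>A\<^sub>s x\<^sup>m\<^sup>-\<^sup>1 \<le> t x\<^sup>[\<^sup>m\<^sup>-\<^sup>1\<^sup>]\<close>. Weak irreducibility confines the normalised candidates to a box \<open>[1, D]\<^sup>n\<close>,
  so a minimiser exists, and one with the fewest tight inequalities has only tight ones.
  A dual eigenpair over this one amounts to a solution of \<open>M x\<^sub>d = (A\<^sub>d - \<lambda>\<^sub>d I) x\<^sub>s\<^sup>m\<^sup>-\<^sup>1\<close>, and
  \<open>M\<close> is an irreducible Z-matrix with \<open>M x\<^sub>s = 0\<close>. Its left and right kernels are spanned by positive
  vectors \<open>y\<close> and \<open>x\<^sub>s\<close>, so the system is solvable iff its right-hand side is orthogonal to \<open>y\<close>, which
  determines \<open>\<lambda>\<^sub>d\<close>; and \<open>y \<bullet> x\<^sub>s > 0\<close> makes the kernel complementary to the range, whence the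
  group inverse.\<close>

section \<open>Irreducible singular Z-matrices\<close>

text \<open>The number t is the largest ratio v_j / x_j. Looking at the index i where v touches t x
  is the comparison argument behind the kernel computation and both spectral radius bounds.\<close>

lemma ratio_max:
  fixes x v :: "real^'n"
  assumes "pos_vec x"
  obtains t i where "\<And>j. v $ j \<le> t * x $ j" "v $ i = t * x $ i"
proof -
  let ?R = "range (\<lambda>j. v $ j / x $ j)"
  have "Max ?R \<in> ?R" by (intro Max_in) auto
  then obtain i where i: "Max ?R = v $ i / x $ i" by (rule rangeE)
  have "v $ j \<le> v $ i / x $ i * x $ j" for j
  proof -
    have "v $ j / x $ j \<le> Max ?R" by (intro Max_ge) auto
    with i assms show ?thesis by (simp add: pos_vec_def pos_divide_le_eq)
  qed
  moreover have "v $ i = v $ i / x $ i * x $ i"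
    using assms by (simp add: pos_vec_def less_imp_neq [symmetric])
  ultimately show thesis by (rule that)
qed

text \<open>In a row i with u_i = 0, the equation (M u)_i = 0 is a vanishing sum of nonpositive
  terms, so u is zero at every out-neighbour of i. Zeros thus spread along paths to all
  indices.\<close>

lemma Z_matrix_nonneg_null_eq_0:
  fixes M :: "real^'n^'n"
  assumes Z: "Z_matrix M" and irr: "irreducible_matrix M"
    and u: "\<And>j. u $ j \<ge> 0" and null: "M *v u = 0" and i0: "u $ i0 = 0"
  shows "u = 0"
proof -
  let ?E = "{(i, j). i \<noteq> j \<and> M $ i $ j \<noteq> 0}"
  have step_null: "u $ j = 0" if "u $ i = 0" "i \<noteq> j" "M $ i $ j \<noteq> 0" for i j
  proof -
    have le: "M $ i $ k * u $ k \<le> 0" for k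
      using Z u[of k] \<open>u $ i = 0\<close>
      by (cases "k = i") (auto simp: Z_matrix_def mult_nonpos_nonneg)
    have "(\<Sum>k\<in>UNIV. - (M $ i $ k * u $ k)) = 0"
      using arg_cong[OF null, of "\<lambda>w. w $ i"] by (simp add: matrix_vector_mult_def sum_negf)
    then have "\<forall>k\<in>UNIV. - (M $ i $ k * u $ k) = 0"
      using le by (subst (asm) sum_nonneg_eq_0_iff) auto
    then have "M $ i $ j * u $ j = 0" by (simp del: mult_eq_0_iff)
    with that show ?thesis by simp
  qed
  have "u $ j = 0" if "(i0, j) \<in> ?E\<^sup>*" for j
    using that
  proof induction
    case (step j k)
    then show ?case by (auto intro: step_null)
  qed (rule i0)
  with irr show ?thesis
    by (simp add: irreducible_matrix_def strongly_connected_def vec_eq_iff)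
qed

text \<open>With t the largest ratio v_j / x_j, the null vector t x - v is nonnegative and has a
  zero entry, hence vanishes.\<close>

lemma Z_matrix_ker:
  fixes M :: "real^'n^'n"
  assumes Z: "Z_matrix M" and irr: "irreducible_matrix M"
    and x: "pos_vec x" and null: "M *v x = 0"
  shows "matrix_ker M = {c *\<^sub>R x | c. True}"
proof (intro set_eqI iffI)
  fix v assume "v \<in> matrix_ker M"
  then have v: "M *v v = 0" by (simp add: matrix_ker_def)
  obtain t i where t: "\<And>j. v $ j \<le> t * x $ j" "v $ i = t * x $ i"
    using ratio_max[OF x] by metis
  have "t *\<^sub>R x - v = 0"
  proof (rule Z_matrix_nonneg_null_eq_0[OF Z irr])
    show "M *v (t *\<^sub>R x - v) = 0"
      by (simp add: matrix_vector_mult_diff_distrib matrix_vector_mult_scaleR null v)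
    show "(t *\<^sub>R x - v) $ j \<ge> 0" for j using t(1)[of j] by simp
    show "(t *\<^sub>R x - v) $ i = 0" using t(2) by simp
  qed
  then have "v = t *\<^sub>R x" by simp
  then show "v \<in> {c *\<^sub>R x | c. True}" by blast
qed (auto simp: matrix_ker_def matrix_vector_mult_scaleR null)

section \<open>Transposition and left null vectors\<close>

lemma Z_matrix_transpose: "Z_matrix M \<Longrightarrow> Z_matrix (transpose M)"
  by (auto simp: Z_matrix_def transpose_def)

lemma irreducible_matrix_transpose:
  assumes "irreducible_matrix M"
  shows "irreducible_matrix (transpose M)"
proof -
  have "{(i, j). i \<noteq> j \<and> transpose M $ i $ j \<noteq> 0} = {(i, j). i \<noteq> j \<and> M $ i $ j \<noteq> 0}\<inverse>"
    by (auto simp: transpose_def)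
  with assms show ?thesis
    by (simp add: irreducible_matrix_def strongly_connected_def rtrancl_converse)
qed

lemma null_vector_det_0:
  fixes M :: "real^'n^'n"
  assumes "M *v x = 0" "x \<noteq> 0"
  shows "det M = 0"
  using assms by (metis invertible_det_nz invertible_left_inverse matrix_left_invertible_ker)

lemma pos_vec_nonzero: "pos_vec x \<Longrightarrow> x \<noteq> 0"
  by (metis less_irrefl pos_vec_def zero_index)

lemma pos_vec_inner_pos: "pos_vec x \<Longrightarrow> pos_vec y \<Longrightarrow> x \<bullet> y > 0"
  by (auto simp: pos_vec_def inner_vec_def intro!: sum_pos)

text \<open>For a left null vector \<open>y\<close> of \<open>M\<close>, every entry of \<open>\<bar>y\<bar>\<^sup>T M\<close> is nonpositive, and pairing
  with \<open>x\<close> shows that they all vanish.\<close>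
lemma Z_matrix_pos_left_null:
  fixes M :: "real^'n^'n"
  assumes Z: "Z_matrix M" and irr: "irreducible_matrix M"
    and x: "pos_vec x" and null: "M *v x = 0"
  obtains y where "pos_vec y" "y v* M = 0"
proof -
  have "det (transpose M) = 0"
    using null_vector_det_0[OF null pos_vec_nonzero[OF x]] by (simp add: det_transpose)
  then obtain y where y: "y v* M = 0" "y \<noteq> 0"
    by (metis invertible_det_nz invertible_left_inverse matrix_left_invertible_ker
        transpose_matrix_vector)
  define u :: "real^'n" where "u = (\<chi> i. \<bar>y $ i\<bar>)"
  have col: "(w v* M) $ j = (\<Sum>i\<in>UNIV. w $ i * M $ i $ j)" for w j
    by (simp add: vector_matrix_mult_def mult.commute)
  \<comment> \<open>The diagonal term is isolated, since only the off-diagonal entries have a known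
    sign. The triangle inequality then bounds it by the remaining terms.\<close>
  have le: "(u v* M) $ j \<le> 0" for j
  proof -
    have "y $ j * M $ j $ j = - (\<Sum>i\<in>UNIV - {j}. y $ i * M $ i $ j)"
      using arg_cong[OF y(1), of "\<lambda>w. w $ j"] by (simp add: col sum.remove[of _ j])
    then have "\<bar>y $ j * M $ j $ j\<bar> = \<bar>\<Sum>i\<in>UNIV - {j}. y $ i * M $ i $ j\<bar>" by simp
    moreover have "u $ j * M $ j $ j \<le> \<bar>y $ j * M $ j $ j\<bar>"
      by (simp add: u_def abs_mult mult_left_mono)
    ultimately have "u $ j * M $ j $ j \<le> \<bar>\<Sum>i\<in>UNIV - {j}. y $ i * M $ i $ j\<bar>" by simp
    also have "\<dots> \<le> (\<Sum>i\<in>UNIV - {j}. \<bar>y $ i * M $ i $ j\<bar>)" by (rule sum_abs)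
    also have "\<dots> = (\<Sum>i\<in>UNIV - {j}. - (u $ i * M $ i $ j))"
      using Z by (intro sum.cong) (auto simp: u_def abs_mult Z_matrix_def)
    finally show ?thesis by (simp add: col sum.remove[of _ j] sum_negf)
  qed
  have "(u v* M) \<bullet> x = 0" by (simp add: dot_lmul_matrix null)
  then have "(\<Sum>j\<in>UNIV. - (u v* M) $ j * x $ j) = 0" by (simp add: inner_vec_def sum_negf)
  then have "\<forall>j\<in>UNIV. - (u v* M) $ j * x $ j = 0"
    using le x by (subst (asm) sum_nonneg_eq_0_iff)
      (auto simp: pos_vec_def mult_nonpos_nonneg less_imp_le)
  then have uM: "u v* M = 0"
    using x by (auto simp: vec_eq_iff pos_vec_def) (metis less_irrefl)
  \<comment> \<open>A nonnegative nonzero null vector of the irreducible Z-matrix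
    \<open>transpose M\<close> cannot have a zero entry.\<close>
  have "u \<noteq> 0" using y(2) by (auto simp: u_def vec_eq_iff)
  then have "u $ i \<noteq> 0" for i
    using Z_matrix_nonneg_null_eq_0[OF Z_matrix_transpose[OF Z] irreducible_matrix_transpose[OF irr], of u i] uM
    by (auto simp: u_def)
  then have "pos_vec u" by (simp add: pos_vec_def u_def)
  with uM show thesis by (rule that[rotated])
qed

text \<open>The transpose is an irreducible Z-matrix with a positive null vector y, so its kernel is
  the line through y. Positivity and the norm then fix the multiple.\<close>

lemma Z_matrix_unique_pos_unit_left_null:
  fixes M :: "real^'n^'n"
  assumes Z: "Z_matrix M" and irr: "irreducible_matrix M"
    and x: "pos_vec x" and null: "M *v x = 0"
  shows "\<exists>!y. pos_unit_left_null M y"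
proof -
  obtain y where y: "pos_vec y" "y v* M = 0" using Z_matrix_pos_left_null[OF assms] .
  have ny: "norm y > 0" using pos_vec_nonzero[OF y(1)] by simp
  show ?thesis
  proof
    show "pos_unit_left_null M ((1 / norm y) *\<^sub>R y)"
      using y ny scaleR_vector_matrix_assoc[of "1 / norm y" y M]
      by (auto simp: pos_unit_left_null_def pos_vec_def)
    fix z assume z: "pos_unit_left_null M z"
    have "z \<in> matrix_ker (transpose M)" using z by (simp add: matrix_ker_def pos_unit_left_null_def)
    then obtain c where c: "z = c *\<^sub>R y"
      using Z_matrix_ker[OF Z_matrix_transpose[OF Z] irreducible_matrix_transpose[OF irr] y(1)] y(2)
      by auto
    have "c > 0"
      using z y(1) by (auto simp: c pos_unit_left_null_def pos_vec_def zero_less_mult_iff dest: less_asym)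
    moreover have "\<bar>c\<bar> * norm y = 1" using z by (simp add: c pos_unit_left_null_def)
    ultimately have "c = 1 / norm y" using ny by (simp add: field_simps)
    then show "z = (1 / norm y) *\<^sub>R y" by (simp add: c)
  qed
qed

text \<open>The shifted matrix B = s I - M is nonnegative with B x = s x, so s is an eigenvalue.
  Comparing the moduli of any complex eigenvector with x shows that no eigenvalue exceeds s in
  modulus.\<close>

lemma Z_matrix_M_matrix:
  fixes M :: "real^'n^'n"
  assumes Z: "Z_matrix M" and x: "pos_vec x" and null: "M *v x = 0"
  shows "M_matrix M"
proof -
  \<comment> \<open>This s dominates every diagonal entry of M, which makes the diagonal of B
    nonnegative.\<close>
  define s where "s = (\<Sum>i\<in>UNIV. \<bar>M $ i $ i\<bar>)"
  define B where "B = mat s - M"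
  have s: "M $ i $ i \<le> s" for i
    using member_le_sum[of i UNIV "\<lambda>i. \<bar>M $ i $ i\<bar>"] by (simp add: s_def)
  have s0: "s \<ge> 0" by (simp add: s_def sum_nonneg)
  have B: "B $ i $ j \<ge> 0" for i j
    using Z s[of i] by (auto simp: B_def mat_def Z_matrix_def)
  have "mat s *v x = s *\<^sub>R x"
    by (simp add: matrix_vector_mult_def mat_def vec_eq_iff if_distrib [where f = "\<lambda>a. a * _"] cong: if_cong)
  then have Bx: "B *v x = s *\<^sub>R x"
    by (simp add: B_def matrix_vector_mult_diff_rdistrib null)
  have Bx': "(\<Sum>j\<in>UNIV. B $ i $ j * x $ j) = s * x $ i" for i
    using arg_cong[OF Bx, of "\<lambda>w. w $ i"] by (simp add: matrix_vector_mult_def)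
  have "is_spectral_radius (matrix_eigenvalues (complex_matrix B)) s"
    unfolding is_spectral_radius_def
  proof
    have "complex_matrix B *v (\<chi> i. complex_of_real (x $ i)) = of_real s *s (\<chi> i. complex_of_real (x $ i))"
      by (simp add: vec_eq_iff matrix_vector_mult_def complex_matrix_def Bx' 
          flip: of_real_mult of_real_sum)
    moreover have "(\<chi> i. complex_of_real (x $ i)) \<noteq> 0"
      using pos_vec_nonzero[OF x] by (simp add: vec_eq_iff)
    ultimately have "complex_of_real s \<in> matrix_eigenvalues (complex_matrix B)"
      unfolding matrix_eigenvalues_def by blast
    then show "s \<in> cmod ` matrix_eigenvalues (complex_matrix B)"
      using s0 by (auto intro!: image_eqI[where x = "complex_of_real s"])
    show "\<forall>l\<in>matrix_eigenvalues (complex_matrix B). cmod l \<le> s"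
    proof
      fix l assume "l \<in> matrix_eigenvalues (complex_matrix B)"
      then obtain v where v: "v \<noteq> 0" "complex_matrix B *v v = l *s v"
        by (auto simp: matrix_eigenvalues_def)
      obtain t i where t: "\<And>j. (\<chi> i. cmod (v $ i)) $ j \<le> t * x $ j"
        "(\<chi> i. cmod (v $ i)) $ i = t * x $ i"
        using ratio_max[OF x] by metis
      obtain k where "v $ k \<noteq> 0" using v(1) by (auto simp: vec_eq_iff)
      then have "0 < t * x $ k" using t(1)[of k] by (metis less_le_trans vec_lambda_beta zero_less_norm_iff)
      then have "t > 0" using x by (metis pos_vec_def zero_less_mult_pos2)
      \<comment> \<open>In the row i where the moduli touch t x, the triangle inequality gives |l| t
        x_i <= t (B x)_i = s t x_i.\<close>
      have "l * v $ i = (\<Sum>j\<in>UNIV. of_real (B $ i $ j) * v $ j)"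
        using arg_cong[OF v(2), of "\<lambda>w. w $ i"] by (simp add: matrix_vector_mult_def complex_matrix_def)
      then have "cmod l * (t * x $ i) = cmod (\<Sum>j\<in>UNIV. of_real (B $ i $ j) * v $ j)"
        using t(2) by (metis norm_mult vec_lambda_beta)
      also have "\<dots> \<le> (\<Sum>j\<in>UNIV. B $ i $ j * (t * x $ j))"
        using B t(1) by (intro sum_norm_le) (auto simp: norm_mult intro!: mult_left_mono)
      also have "\<dots> = t * (\<Sum>j\<in>UNIV. B $ i $ j * x $ j)"
        by (simp add: sum_distrib_left mult_ac)
      also have "\<dots> = s * (t * x $ i)" by (simp add: Bx')
      finally show "cmod l \<le> s" using \<open>t > 0\<close> x by (simp add: pos_vec_def)
    qed
  qed
  moreover have "M = mat s - B" by (simp add: B_def)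
  ultimately show ?thesis using Z B unfolding M_matrix_def by blast
qed

text \<open>With \<open>P\<close> the projection onto the kernel along the range, \<open>M + P\<close> is invertible and
  \<open>(M + P)\<^sup>-\<^sup>1 - P\<close> is the group inverse.\<close>
lemma group_inverse_simple_kernel:
  fixes M :: "real^'n^'n"
  assumes x: "M *v x = 0" and y: "y v* M = 0" and yx: "y \<bullet> x \<noteq> 0"
    and ker: "matrix_ker M = {c *\<^sub>R x | c. True}"
  obtains G where "is_group_inverse M G"
    "\<And>v b. M *v v = b \<Longrightarrow> y \<bullet> v = 0 \<Longrightarrow> v = G *v b"
    "\<And>b. y \<bullet> b = 0 \<Longrightarrow> M *v (G *v b) = b"
proof -
  define P where "P v = ((y \<bullet> v) / (y \<bullet> x)) *\<^sub>R x" for v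
  have linP: "linear P"
    by (auto simp: P_def linear_iff inner_add_right add_divide_distrib scaleR_add_left)
  have yM: "y \<bullet> (M *v v) = 0" for v
    using dot_lmul_matrix[of y M v] y by simp
  have MP: "M *v P v = 0" for v by (simp add: P_def matrix_vector_mult_scaleR x)
  have PM: "P (M *v v) = 0" for v by (simp add: P_def yM)
  have PP: "P (P v) = P v" for v using yx by (simp add: P_def)
  define K where "K = matrix (\<lambda>v. M *v v + P v)"
  have K: "K *v v = M *v v + P v" for v
    unfolding K_def using linP
    by (subst matrix_works) (auto simp: linear_matrix_vector_mul_eq intro: linear_compose_add)
  \<comment> \<open>Pairing with y removes M v and leaves y . v = 0. Hence P v = 0, so M v = 0, and
    v is a multiple of x orthogonal to y.\<close>
  have "v = 0" if "K *v v = 0" for v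
  proof -
    have "y \<bullet> (K *v v) = y \<bullet> v" using yx by (simp add: K inner_add_right yM P_def)
    with that have yv: "y \<bullet> v = 0" by simp
    then have "v \<in> matrix_ker M" using that by (simp add: K P_def matrix_ker_def)
    with ker yv yx show ?thesis by auto
  qed
  then obtain N where NK: "N ** K = mat 1" by (metis matrix_left_invertible_ker)
  then have KN: "K ** N = mat 1" by (simp add: matrix_left_right_inverse)
  have NK': "N *v (K *v v) = v" and KN': "K *v (N *v v) = v" for v
    using NK KN by (simp_all add: matrix_vector_mul_assoc)
  \<comment> \<open>K fixes the range of P because M P = 0 and P P = P, so its inverse N does too.
    It follows that N M = M N = I - P.\<close>
  have NP: "N *v P v = P v" for v
    using NK'[of "P v"] by (simp add: K MP PP)
  have PN: "P (N *v v) = P v" for v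
    using arg_cong[OF KN'[of v], of P] by (simp add: K linear_add[OF linP] PM PP)
  have NM: "N *v (M *v v) = v - P v" for v
    using NK'[of v] by (simp add: K matrix_vector_right_distrib NP eq_diff_eq)
  have MN: "M *v (N *v v) = v - P v" for v
    using KN'[of v] by (simp add: K PN eq_diff_eq)
  define G where "G = N - matrix P"
  have G: "G *v v = N *v v - P v" for v
    using linP
    by (simp add: G_def matrix_vector_mult_diff_rdistrib matrix_works linear_matrix_vector_mul_eq)
  have P_diff: "P (u - v) = P u - P v" for u v by (rule linear_diff[OF linP])
  \<comment> \<open>Since P M = M P = 0, both G M and M G equal I - P, and P G = 0. This yields all
    three defining equations.\<close>
  have "is_group_inverse M G"
    by (simp add: is_group_inverse_def matrix_eq G NM MN MP PM PN NP PP P_diff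
        matrix_vector_mult_diff_distrib flip: matrix_vector_mul_assoc)
  moreover have "v = G *v b" if "M *v v = b" "y \<bullet> v = 0" for v b
    using that(2) by (auto simp: G NM PM P_def yM simp flip: that(1))
  moreover have "M *v (G *v b) = b" if "y \<bullet> b = 0" for b
    using that by (simp add: G matrix_vector_mult_diff_distrib MN MP) (simp add: P_def)
  ultimately show thesis by (rule that)
qed

section \<open>Perron-Frobenius theory of weakly irreducible tensors\<close>

lemma prod_list_mono:
  fixes f g :: "'a \<Rightarrow> real"
  assumes "\<And>j. j \<in> set js \<Longrightarrow> 0 \<le> f j \<and> f j \<le> g j"
  shows "(\<Prod>j\<leftarrow>js. f j) \<le> (\<Prod>j\<leftarrow>js. g j)"
  using assms
proof (induction js)
  case (Cons a js)
  have "0 \<le> (\<Prod>j\<leftarrow>js. f j)" using Cons.prems by (intro prod_list_nonneg) auto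
  moreover have "0 \<le> f a" "f a \<le> g a" using Cons.prems[of a] by auto
  moreover have "(\<Prod>j\<leftarrow>js. f j) \<le> (\<Prod>j\<leftarrow>js. g j)" using Cons by auto
  ultimately show ?case by (auto intro!: mult_mono)
qed simp

lemma prod_list_pos:
  fixes f :: "'a \<Rightarrow> real"
  shows "(\<And>j. j \<in> set js \<Longrightarrow> 0 < f j) \<Longrightarrow> 0 < (\<Prod>j\<leftarrow>js. f j)"
  by (induction js) auto

lemma prod_list_strict_mono:
  fixes f g :: "'a \<Rightarrow> real"
  assumes "\<And>j. 0 < f j" "\<And>j. f j \<le> g j" "f k < g k" "k \<in> set js"
  shows "(\<Prod>j\<leftarrow>js. f j) < (\<Prod>j\<leftarrow>js. g j)"
proof -
  obtain us vs where js: "js = us @ k # vs" using \<open>k \<in> set js\<close> by (auto dest: split_list)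
  have f: "0 < (\<Prod>j\<leftarrow>us. f j)" "0 < (\<Prod>j\<leftarrow>vs. f j)"
    using assms(1) by (simp_all add: prod_list_pos)
  have le: "(\<Prod>j\<leftarrow>us. f j) \<le> (\<Prod>j\<leftarrow>us. g j)" "(\<Prod>j\<leftarrow>vs. f j) \<le> (\<Prod>j\<leftarrow>vs. g j)"
    by (rule prod_list_mono; simp add: assms less_imp_le)+
  have "f k * (\<Prod>j\<leftarrow>vs. f j) < g k * (\<Prod>j\<leftarrow>vs. g j)"
    by (rule mult_less_le_imp_less) (use f le assms(1,3) in \<open>simp_all add: less_imp_le\<close>)
  then have "(\<Prod>j\<leftarrow>us. f j) * (f k * (\<Prod>j\<leftarrow>vs. f j)) < (\<Prod>j\<leftarrow>us. g j) * (g k * (\<Prod>j\<leftarrow>vs. g j))"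
    by (rule mult_le_less_imp_less[rotated])
      (use f le assms(1)[of k] in \<open>simp_all add: less_imp_le\<close>)
  then show ?thesis by (simp add: js)
qed

lemma prod_list_scale:
  fixes f :: "'a \<Rightarrow> 'b::comm_semiring_1"
  shows "(\<Prod>j\<leftarrow>js. c * f j) = c ^ length js * (\<Prod>j\<leftarrow>js. f j)"
  by (induction js) (simp_all add: mult_ac)

lemma finite_lists_of_length [simp]: "finite {js :: 'n::finite list. length js = k}"
  using finite_lists_length_eq[of "UNIV :: 'n set" k] by simp

lemma tensor_apply_scale:
  "tensor_apply m A (c *s x) = c ^ (m - 1) *s tensor_apply m A x"
  by (simp add: tensor_apply_def vec_eq_iff prod_list_scale sum_distrib_left mult_ac)

lemma nonneg_tensorD: "nonneg_tensor m A \<Longrightarrow> m \<ge> 2 \<Longrightarrow> length js = m - 1 \<Longrightarrow> A (i # js) \<ge> 0"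
  by (auto simp: nonneg_tensor_def)

lemma tensor_apply_mono:
  fixes x x' :: "real^'n::finite"
  assumes m: "m \<ge> 2" and A: "nonneg_tensor m A" and x: "\<And>j. 0 \<le> x $ j" "\<And>j. x $ j \<le> x' $ j"
  shows "tensor_apply m A x $ i \<le> tensor_apply m A x' $ i"
  unfolding tensor_apply_def using x
  by (auto intro!: sum_mono mult_left_mono prod_list_mono nonneg_tensorD[OF A m])

text \<open>The monomial witnessing the arc (i, j) contains x_j and has a positive coefficient, so
  it strictly increases while no other term decreases.\<close>

lemma tensor_apply_strict_mono:
  fixes x x' :: "real^'n::finite"
  assumes m: "m \<ge> 2" and A: "nonneg_tensor m A" and x: "pos_vec x" "\<And>j. x $ j \<le> x' $ j"
    and arc: "(i, j) \<in> tensor_arcs m A" and lt: "x $ j < x' $ j"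
  shows "tensor_apply m A x $ i < tensor_apply m A x' $ i"
proof -
  obtain js where js: "length js = m - 1" "A (i # js) \<noteq> 0" "j \<in> set js"
    using arc by (auto simp: tensor_arcs_def)
  have "A (i # js) > 0" using js(1,2) A m by (metis nonneg_tensorD order_le_less)
  moreover have "(\<Prod>p\<leftarrow>js. x $ p) < (\<Prod>p\<leftarrow>js. x' $ p)"
    using x lt js(3) by (intro prod_list_strict_mono[of _ _ j]) (auto simp: pos_vec_def)
  ultimately show ?thesis
    unfolding tensor_apply_def vec_lambda_beta using js(1) x
    by (intro sum_strict_mono_ex1)
      (auto intro!: mult_left_mono prod_list_mono nonneg_tensorD[OF A m] bexI[of _ js]
        simp: pos_vec_def less_imp_le)
qed

lemma term_le_tensor_apply:
  fixes x :: "real^'n::finite"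
  assumes m: "m \<ge> 2" and A: "nonneg_tensor m A" and x: "\<And>j. 0 \<le> x $ j"
    and js: "length js = m - 1"
  shows "A (i # js) * (\<Prod>j\<leftarrow>js. x $ j) \<le> tensor_apply m A x $ i"
  unfolding tensor_apply_def vec_lambda_beta using x js
  by (intro member_le_sum) (auto intro!: mult_nonneg_nonneg prod_list_nonneg nonneg_tensorD[OF A m])

text \<open>Row i has a nonzero entry. In dimension at least 2 it comes from the first arc of a path
  leaving i, in dimension 1 from the exclusion of the zero tensor.\<close>

lemma tensor_apply_pos:
  fixes A :: "(real, 'n::finite) tensor"
  assumes m: "m \<ge> 2" and A: "nonneg_tensor m A" and irr: "weakly_irreducible m A"
    and x: "pos_vec x"
  shows "tensor_apply m A x $ i > 0"
proof -
  have "\<exists>js. length js = m - 1 \<and> A (i # js) \<noteq> 0"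
  proof (cases "\<exists>j. j \<noteq> i")
    case True
    then obtain j where "j \<noteq> i" by blast
    moreover have "(i, j) \<in> (tensor_arcs m A)\<^sup>*"
      using irr by (simp add: weakly_irreducible_def strongly_connected_def)
    ultimately obtain k where "(i, k) \<in> tensor_arcs m A" by (metis converse_rtranclE)
    then show ?thesis by (auto simp: tensor_arcs_def)
  next
    case False
    then have "UNIV = {i}" by auto
    then have "CARD('n) = 1" by (metis card_1_singleton_iff One_nat_def)
    then obtain ks where ks: "length ks = m" "A ks \<noteq> 0"
      using irr by (auto simp: weakly_irreducible_def)
    then obtain a js where "ks = a # js" using m by (cases ks) auto
    with ks False show ?thesis by (metis One_nat_def diff_Suc_1 length_Cons)
  qed
  then obtain js where js: "length js = m - 1" "A (i # js) \<noteq> 0" by blast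
  then have "A (i # js) > 0" using A m by (metis nonneg_tensorD order_le_less)
  moreover have "(\<Prod>j\<leftarrow>js. x $ j) > 0" using x by (simp add: prod_list_pos pos_vec_def)
  ultimately have "0 < A (i # js) * (\<Prod>j\<leftarrow>js. x $ j)" by simp
  also have "\<dots> \<le> tensor_apply m A x $ i"
    using js x by (intro term_le_tensor_apply m A) (auto simp: pos_vec_def less_imp_le)
  finally show ?thesis .
qed

section \<open>Existence of a positive eigenvector by minimisation\<close>

lemma continuous_on_prod_list [continuous_intros]:
  fixes f :: "'b::topological_space \<Rightarrow> 'a \<Rightarrow> 'c::real_normed_algebra_1"
  shows "(\<And>j. continuous_on S (\<lambda>x. f x j)) \<Longrightarrow> continuous_on S (\<lambda>x. \<Prod>j\<leftarrow>js. f x j)"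
  by (induction js) (auto intro!: continuous_intros)

text \<open>For fixed positive x, the least admissible t is the Collatz-Wielandt quotient, the
  largest ratio of (A x^(m-1))_i to x_i^(m-1).\<close>

definition subeigen :: "nat \<Rightarrow> (real, 'n::finite) tensor \<Rightarrow> real \<Rightarrow> real^'n \<Rightarrow> bool" where
  "subeigen m A t x \<longleftrightarrow> pos_vec x \<and> (\<forall>i. tensor_apply m A x $ i \<le> t * x $ i ^ (m - 1))"

lemma subeigen_scale:
  assumes "subeigen m A t x" "c > 0"
  shows "subeigen m A t (c *s x)"
  using assms
  by (auto simp: subeigen_def pos_vec_def tensor_apply_scale power_mult_distrib mult.left_commute)

text \<open>Along an arc \<open>(i, j)\<close> the monomial containing \<open>x\<^sub>j\<close> is at least a constant times \<open>x\<^sub>j\<close>, because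
  all other entries are at least 1; so a bound on \<open>x\<^sub>i\<close> propagates to \<open>x\<^sub>j\<close>.\<close>
lemma subeigen_bounded_along_path:
  fixes A :: "(real, 'n::finite) tensor"
  assumes m: "m \<ge> 2" and A: "nonneg_tensor m A" and path: "(i, j) \<in> (tensor_arcs m A)\<^sup>*"
    and "b \<ge> 0"
  shows "\<exists>C. \<forall>x. subeigen m A b x \<and> (\<forall>k. x $ k \<ge> 1) \<and> x $ i = 1 \<longrightarrow> x $ j \<le> C"
  using path
proof induction
  case base
  then show ?case by auto
next
  case (step j k)
  then obtain C where C: "\<And>x. subeigen m A b x \<Longrightarrow> \<forall>k. x $ k \<ge> 1 \<Longrightarrow> x $ i = 1 \<Longrightarrow> x $ j \<le> C"
    by blast
  obtain js where js: "length js = m - 1" "A (j # js) \<noteq> 0" "k \<in> set js"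
    using step.hyps(2) by (auto simp: tensor_arcs_def)
  have a: "A (j # js) > 0" using js(1,2) A m by (metis nonneg_tensorD order_le_less)
  have "x $ k \<le> b * C ^ (m - 1) / A (j # js)"
    if x: "subeigen m A b x" "\<forall>k. x $ k \<ge> 1" "x $ i = 1" for x
  proof -
    have x0: "0 \<le> x $ p" for p using x(2) by (metis order_trans zero_le_one)
    have ge: "1 \<le> (\<Prod>p\<leftarrow>ps. x $ p)" for ps
      using prod_list_mono[of ps "\<lambda>_. 1" "\<lambda>p. x $ p"] x(2) by (simp add: map_replicate_const)
    obtain us vs where "js = us @ k # vs" using js(3) by (auto dest: split_list)
    then have "(\<Prod>p\<leftarrow>js. x $ p) = x $ k * ((\<Prod>p\<leftarrow>us. x $ p) * (\<Prod>p\<leftarrow>vs. x $ p))" by simp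
    moreover have "1 \<le> (\<Prod>p\<leftarrow>us. x $ p) * (\<Prod>p\<leftarrow>vs. x $ p)"
      using mult_mono[OF ge[of us] ge[of vs]] ge[of us] by simp
    ultimately have "x $ k \<le> (\<Prod>p\<leftarrow>js. x $ p)"
      using mult_left_mono[OF _ x0[of k]] by fastforce
    then have "A (j # js) * x $ k \<le> A (j # js) * (\<Prod>p\<leftarrow>js. x $ p)" using a by simp
    also have "\<dots> \<le> tensor_apply m A x $ j" by (rule term_le_tensor_apply[OF m A x0 js(1)])
    also have "\<dots> \<le> b * x $ j ^ (m - 1)" using x(1) by (simp add: subeigen_def)
    also have "\<dots> \<le> b * C ^ (m - 1)"
      using C[OF x] x0 \<open>b \<ge> 0\<close> by (intro mult_left_mono power_mono) auto
    finally show ?thesis using a by (simp add: pos_le_divide_eq mult.commute)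
  qed
  then show ?case by blast
qed

text \<open>Scaling the smallest entry of x to 1 keeps t and places the candidates with t <= b in a
  compact set, on which t attains its minimum.\<close>

lemma subeigen_minimal:
  fixes A :: "(real, 'n::finite) tensor"
  assumes m: "m \<ge> 2" and A: "nonneg_tensor m A" and irr: "weakly_irreducible m A"
  obtains t x where "subeigen m A t x" "\<And>t' x'. subeigen m A t' x' \<Longrightarrow> t \<le> t'"
proof -
  \<comment> \<open>The level b is admissible for the all-ones vector, so only levels up to b
    compete.\<close>
  define b where "b = (\<Sum>i\<in>UNIV. tensor_apply m A 1 $ i)"
  have nn: "tensor_apply m A x $ i \<ge> 0" if "pos_vec x" for x i
    using tensor_apply_pos[OF m A irr that] by (simp add: less_imp_le)
  have one: "pos_vec (1 :: real^'n)" by (simp add: pos_vec_def)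
  have b0: "b \<ge> 0" unfolding b_def by (intro sum_nonneg nn[OF one])
  have b1: "subeigen m A b 1"
    using one member_le_sum[of _ UNIV "\<lambda>i. tensor_apply m A 1 $ i"] nn[OF one]
    by (simp add: subeigen_def b_def)
  have "\<exists>C. \<forall>x. subeigen m A b x \<and> (\<forall>k. x $ k \<ge> 1) \<and> x $ i = 1 \<longrightarrow> x $ j \<le> C" for i j
    using irr subeigen_bounded_along_path[OF m A _ b0]
    by (simp add: weakly_irreducible_def strongly_connected_def)
  then obtain C where C: "\<And>i j x. subeigen m A b x \<Longrightarrow> \<forall>k. x $ k \<ge> 1 \<Longrightarrow> x $ i = 1 \<Longrightarrow> x $ j \<le> C i j"
    by metis
  \<comment> \<open>One bound for every position i of the entry 1 and every other position
    j.\<close>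
  define D where "D = Max (range (\<lambda>(i, j). C i j))"
  have D: "C i j \<le> D" for i j
    unfolding D_def by (rule Max_ge) (auto intro: range_eqI[of _ _ "(i, j)"])
  define S where "S = (cbox 1 (\<chi> i. D) \<times> {0..b}) \<inter>
    {p :: (real^'n) \<times> real. \<forall>i. tensor_apply m A (fst p) $ i \<le> snd p * fst p $ i ^ (m - 1)}"
  have "compact S"
    unfolding S_def tensor_apply_def vec_lambda_beta
    by (intro compact_Int_closed compact_Times compact_cbox compact_Icc closed_Collect_all
        closed_Collect_le continuous_intros)
  have normalize: "\<exists>y. (y, t) \<in> S" if tx: "subeigen m A t x" and "t \<le> b" for t x
  proof -
    have xpos: "x $ i > 0" for i using tx by (simp add: subeigen_def pos_vec_def)
    have "\<exists>i. \<forall>j. x $ i \<le> x $ j"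
      using ex_min_if_finite[of "range (\<lambda>i. x $ i)"] by (auto simp: not_less)
    then obtain i where i: "\<And>j. x $ i \<le> x $ j" by blast
    define y where "y = (1 / x $ i) *s x"
    have y: "subeigen m A t y" unfolding y_def using xpos tx by (intro subeigen_scale) auto
    have y1: "y $ k \<ge> 1" for k using i xpos by (simp add: y_def)
    have yi: "y $ i = 1" using xpos[of i] by (simp add: y_def)
    have "t * y $ j ^ (m - 1) \<le> b * y $ j ^ (m - 1)" for j
      using \<open>t \<le> b\<close> y1[of j] by (intro mult_right_mono) auto
    \<comment> \<open>Raising the level from t to b makes the uniform bound D applicable.\<close>
    then have "subeigen m A b y" using y by (auto simp: subeigen_def intro: order_trans)
    then have "y $ j \<le> D" for j using C[of y i j] D[of i j] y1 yi by auto
    moreover have "0 \<le> t"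
    proof -
      have "0 \<le> t * y $ i ^ (m - 1)"
        using y nn[of y i] by (metis order_trans subeigen_def)
      then show ?thesis by (simp add: yi)
    qed
    ultimately have "(y, t) \<in> S"
      using y y1 \<open>t \<le> b\<close> by (auto simp: S_def mem_box_cart subeigen_def)
    then show ?thesis by blast
  qed
  have "S \<noteq> {}" using normalize[OF b1] by blast
  then obtain p where p: "p \<in> S" "\<And>q. q \<in> S \<Longrightarrow> snd p \<le> snd q"
    using continuous_attains_inf[OF \<open>compact S\<close>, of snd] continuous_on_snd[OF continuous_on_id] by blast
  show thesis
  proof
    have "1 \<le> fst p $ i" for i
      using p(1) by (auto simp: S_def mem_box_cart)
    then have "0 < fst p $ i" for i by (rule less_le_trans[OF zero_less_one])
    with p(1) show "subeigen m A (snd p) (fst p)"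
      by (auto simp: S_def subeigen_def pos_vec_def)
    fix t' x' assume *: "subeigen m A t' x'"
    show "snd p \<le> t'"
    proof (cases "t' \<le> b")
      case True
      then show ?thesis using normalize[OF *] p(2) by fastforce
    next
      case False
      then show ?thesis using p(1) by (auto simp: S_def)
    qed
  qed
qed

text \<open>Among the vectors realising the minimal \<open>t\<close>, one with the fewest tight indices is an
  eigenvector: otherwise some tight \<open>i\<close> has an arc to a slack \<open>j\<close>, and lowering \<open>x\<^sub>j\<close> slightly
  makes \<open>i\<close> slack too.\<close>
theorem weakly_irreducible_pos_eigenvector:
  fixes A :: "(real, 'n::finite) tensor"
  assumes m: "m \<ge> 2" and A: "nonneg_tensor m A" and irr: "weakly_irreducible m A"
  obtains t x where "t > 0" "pos_vec x" "tensor_apply m A x = t *s vec_power x (m - 1)"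
proof -
  obtain t x0 where x0: "subeigen m A t x0" and t_min: "\<And>t' x'. subeigen m A t' x' \<Longrightarrow> t \<le> t'"
    using subeigen_minimal[OF assms] by metis
  define I where "I x = {i. tensor_apply m A x $ i = t * x $ i ^ (m - 1)}" for x
  obtain x where x: "subeigen m A t x" and I_min: "\<And>y. subeigen m A t y \<Longrightarrow> card (I x) \<le> card (I y)"
    using ex_has_least_nat[of "subeigen m A t" x0 "\<lambda>x. card (I x)"] x0 by blast
  have xpos: "x $ i > 0" for i using x by (simp add: subeigen_def pos_vec_def)
  have x_le: "tensor_apply m A x $ i \<le> t * x $ i ^ (m - 1)" for i using x by (simp add: subeigen_def)
  have "0 < t * x $ i ^ (m - 1)" for i
    using x by (intro less_le_trans[OF tensor_apply_pos[OF assms] x_le]) (simp add: subeigen_def)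
  then have "t > 0" using xpos by (metis zero_less_mult_pos2 zero_less_power)
  \<comment> \<open>If every inequality were slack, the largest ratio r would be an admissible level
    below t.\<close>
  have "I x \<noteq> {}"
  proof
    assume "I x = {}"
    then have lt: "tensor_apply m A x $ i < t * x $ i ^ (m - 1)" for i
      using x_le[of i] by (auto simp: I_def less_le)
    define r where "r = Max (range (\<lambda>i. tensor_apply m A x $ i / x $ i ^ (m - 1)))"
    have "r < t" unfolding r_def using lt xpos by (subst Max_less_iff) (auto simp: pos_divide_less_eq)
    have "tensor_apply m A x $ i / x $ i ^ (m - 1) \<le> r" for i unfolding r_def by (intro Max_ge) auto
    then have "subeigen m A r x"
      using x xpos by (auto simp: subeigen_def pos_divide_le_eq)
    with t_min \<open>r < t\<close> show False by force
  qed
  have "I x = UNIV"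
  proof (rule ccontr)
    assume "I x \<noteq> UNIV"
    then obtain k where k: "k \<notin> I x" by blast
    obtain i0 where i0: "i0 \<in> I x" using \<open>I x \<noteq> {}\<close> by blast
    have "(i0, k) \<in> (tensor_arcs m A)\<^sup>*"
      using irr by (simp add: weakly_irreducible_def strongly_connected_def)
    \<comment> \<open>A path from a tight index to a slack one must cross from tight to slack along
      some arc.\<close>
    then have "\<exists>i j. i \<in> I x \<and> j \<notin> I x \<and> (i, j) \<in> tensor_arcs m A"
      using k by induction (use i0 in blast)+
    then obtain i j where ij: "i \<in> I x" "j \<notin> I x" "(i, j) \<in> tensor_arcs m A" by blast
    have "tensor_apply m A x $ j / t < x $ j ^ (m - 1)"
      using x_le[of j] ij(2) \<open>t > 0\<close> by (simp add: I_def pos_divide_less_eq mult.commute)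
    moreover have "0 < x $ j ^ (m - 1)" using xpos by simp
    \<comment> \<open>The number q will be the new value of x_j^(m-1). Its lower bound keeps j slack
      even against the old left-hand side, which the change cannot increase.\<close>
    ultimately obtain q where q: "tensor_apply m A x $ j / t < q" "0 < q" "q < x $ j ^ (m - 1)"
      using dense[of "max (tensor_apply m A x $ j / t) 0" "x $ j ^ (m - 1)"] by auto
    define s where "s = root (m - 1) q"
    have m1: "m - 1 > 0" using m by simp
    have s: "s > 0" "s ^ (m - 1) = q" using q m1 by (simp_all add: s_def)
    then have sx: "s < x $ j" using q(3) xpos[of j] by (metis power_less_imp_less_base less_imp_le)
    define y where "y = (\<chi> p. if p = j then s else x $ p)"
    have ypos: "pos_vec y" using xpos s by (simp add: y_def pos_vec_def)
    have yx: "y $ p \<le> x $ p" for p using sx by (simp add: y_def)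
    have le: "tensor_apply m A y $ p \<le> tensor_apply m A x $ p" for p
      by (rule tensor_apply_mono[OF m A]) (use ypos yx in \<open>auto simp: pos_vec_def less_imp_le\<close>)
    have lt_i: "tensor_apply m A y $ i < tensor_apply m A x $ i"
      by (rule tensor_apply_strict_mono[OF m A ypos yx ij(3)]) (simp add: y_def sx)
    have lt_j: "tensor_apply m A y $ j < t * y $ j ^ (m - 1)"
      using le[of j] q(1) s \<open>t > 0\<close> by (simp add: y_def pos_divide_less_eq mult.commute)
    have y_other: "y $ p = x $ p" if "p \<noteq> j" for p using that by (simp add: y_def)
    have "tensor_apply m A y $ p \<le> t * y $ p ^ (m - 1)" for p
      using lt_j le[of p] x_le[of p] y_other[of p] by (cases "p = j") auto
    then have "subeigen m A t y" using ypos by (simp add: subeigen_def)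
    \<comment> \<open>No index becomes tight: j stays slack, and elsewhere the right-hand side is
      unchanged while the left-hand side does not grow. The tight index i becomes slack.\<close>
    moreover have "I y \<subset> I x"
    proof
      show "I y \<subseteq> I x"
      proof
        fix p assume "p \<in> I y"
        then have "tensor_apply m A y $ p = t * y $ p ^ (m - 1)" by (simp add: I_def)
        with lt_j have "p \<noteq> j" by auto
        then show "p \<in> I x"
          using \<open>p \<in> I y\<close> le[of p] x_le[of p] y_other[of p] by (auto simp: I_def)
      qed
      have "i \<noteq> j" using ij by blast
      then have "i \<notin> I y" using ij(1) lt_i y_other[of i] by (auto simp: I_def)
      with ij(1) show "I y \<noteq> I x" by blast
    qed
    then have "card (I y) < card (I x)" by (intro psubset_card_mono) auto
    ultimately show False using I_min by force
  qed
  then have "tensor_apply m A x = t *s vec_power x (m - 1)"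
    by (auto simp: I_def vec_eq_iff vec_power_def)
  with \<open>t > 0\<close> x show thesis by (intro that) (auto simp: subeigen_def)
qed

text \<open>The comparison used for matrices carries over: with |v| <= t x touching at i,
  homogeneity of degree m - 1 puts the same factor t^(m-1) on both sides of row i.\<close>

lemma tensor_spectral_radius:
  fixes A :: "(real, 'n::finite) tensor"
  assumes m: "m \<ge> 2" and A: "nonneg_tensor m A" and x: "pos_vec x"
    and eig: "tensor_apply m A x = s *s vec_power x (m - 1)" and s0: "s \<ge> 0"
  shows "is_spectral_radius (tensor_eigenvalues m (\<lambda>is. complex_of_real (A is))) s"
  unfolding is_spectral_radius_def
proof
  let ?A = "\<lambda>is. complex_of_real (A is)"
  let ?z = "\<chi> i. complex_of_real (x $ i)"
  have eig': "(\<Sum>js | length js = m - 1. A (i # js) * (\<Prod>j\<leftarrow>js. x $ j)) = s * x $ i ^ (m - 1)" for i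
    using arg_cong[OF eig, of "\<lambda>w. w $ i"] by (simp add: tensor_apply_def vec_power_def)
  have of_real_prod: "(\<Prod>j\<leftarrow>js. complex_of_real (x $ j)) = of_real (\<Prod>j\<leftarrow>js. x $ j)" for js
    by (induction js) auto
  have "tensor_apply m ?A ?z = of_real s *s vec_power ?z (m - 1)"
    by (simp add: vec_eq_iff tensor_apply_def vec_power_def of_real_prod eig'
        del: One_nat_def flip: of_real_mult of_real_sum of_real_power)
  moreover have "?z \<noteq> 0"
    using pos_vec_nonzero[OF x] by (simp add: vec_eq_iff)
  ultimately have "complex_of_real s \<in> tensor_eigenvalues m ?A"
    unfolding tensor_eigenvalues_def by blast
  then show "s \<in> cmod ` tensor_eigenvalues m ?A"
    using s0 by (auto intro!: image_eqI[where x = "complex_of_real s"])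
  show "\<forall>l\<in>tensor_eigenvalues m ?A. cmod l \<le> s"
  proof
    fix l assume "l \<in> tensor_eigenvalues m ?A"
    then obtain v where v: "v \<noteq> 0" "tensor_apply m ?A v = l *s vec_power v (m - 1)"
      by (auto simp: tensor_eigenvalues_def)
    obtain t i where t: "\<And>j. (\<chi> i. cmod (v $ i)) $ j \<le> t * x $ j"
      "(\<chi> i. cmod (v $ i)) $ i = t * x $ i"
      using ratio_max[OF x] by metis
    obtain k where "v $ k \<noteq> 0" using v(1) by (auto simp: vec_eq_iff)
    then have "0 < t * x $ k" using t(1)[of k] by (metis less_le_trans vec_lambda_beta zero_less_norm_iff)
    then have "t > 0" using x by (metis pos_vec_def zero_less_mult_pos2)
    have norm_prod: "cmod (\<Prod>j\<leftarrow>js. v $ j) = (\<Prod>j\<leftarrow>js. cmod (v $ j))" for js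
      by (induction js) (auto simp: norm_mult)
    have "l * v $ i ^ (m - 1) = (\<Sum>js | length js = m - 1. of_real (A (i # js)) * (\<Prod>j\<leftarrow>js. v $ j))"
      using arg_cong[OF v(2), of "\<lambda>w. w $ i"] by (simp add: tensor_apply_def vec_power_def)
    then have "cmod l * (t * x $ i) ^ (m - 1) =
        cmod (\<Sum>js | length js = m - 1. of_real (A (i # js)) * (\<Prod>j\<leftarrow>js. v $ j))"
      using t(2) by (metis norm_mult norm_power vec_lambda_beta)
    also have "\<dots> \<le> (\<Sum>js | length js = m - 1. A (i # js) * (\<Prod>j\<leftarrow>js. t * x $ j))"
    proof (rule sum_norm_le)
      fix js :: "'n list" assume "js \<in> {js. length js = m - 1}"
      then have "A (i # js) \<ge> 0" using A m by (simp add: nonneg_tensorD)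
      moreover have "(\<Prod>j\<leftarrow>js. cmod (v $ j)) \<le> (\<Prod>j\<leftarrow>js. t * x $ j)"
        using t(1) by (intro prod_list_mono) auto
      ultimately show "cmod (of_real (A (i # js)) * (\<Prod>j\<leftarrow>js. v $ j)) \<le> A (i # js) * (\<Prod>j\<leftarrow>js. t * x $ j)"
        by (simp add: norm_mult norm_prod mult_left_mono)
    qed
    also have "\<dots> = t ^ (m - 1) * (\<Sum>js | length js = m - 1. A (i # js) * (\<Prod>j\<leftarrow>js. x $ j))"
      by (simp add: sum_distrib_left prod_list_scale mult_ac)
    also have "\<dots> = s * (t * x $ i) ^ (m - 1)" by (simp add: eig' power_mult_distrib del: One_nat_def)
    finally show "cmod l \<le> s" using \<open>t > 0\<close> x by (simp add: pos_vec_def)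
  qed
qed

section \<open>The linearised eigenvalue problem\<close>

text \<open>Insertion at position k is a bijection onto the longer lists. It turns products with
  \<open>partial_matrix\<close> into sums over whole index tails.\<close>

lemma sum_lists_insert_at:
  fixes f :: "'n::finite list \<Rightarrow> 'a::comm_monoid_add"
  assumes "k \<le> n"
  shows "(\<Sum>j\<in>UNIV. \<Sum>js | length js = n. f (take k js @ j # drop k js)) =
    (\<Sum>js | length js = Suc n. f js)"
proof -
  have "(\<Sum>j\<in>UNIV. \<Sum>js | length js = n. f (take k js @ j # drop k js)) =
      (\<Sum>(j, js)\<in>UNIV \<times> {js. length js = n}. f (take k js @ j # drop k js))"
    by (rule sum.cartesian_product)
  also have "\<dots> = (\<Sum>js | length js = Suc n. f js)"
    by (rule sum.reindex_bij_witness[of _ "\<lambda>ls. (ls ! k, take k ls @ drop (Suc k) ls)"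
          "\<lambda>(j, js). take k js @ j # drop k js"])
      (use assms in \<open>auto simp: nth_append min_def Cons_nth_drop_Suc\<close>)
  finally show ?thesis .
qed

text \<open>The tail \<open>js\<close> holds the indices from the second one on, counted from 0, so
  position p corresponds to k = p + 2. The factor of x at that position is replaced by one of
  v.\<close>

lemma partial_matrix_mult:
  fixes A :: "(real, 'n::finite) tensor"
  assumes "p \<le> m - 2" "m \<ge> 2"
  shows "(partial_matrix m A x (p + 2) *v v) $ i =
    (\<Sum>js | length js = m - 1.
       A (i # js) * (v $ (js ! p) * (\<Prod>q\<leftarrow>take p js @ drop (Suc p) js. x $ q)))"
proof -
  define f where "f js = A (i # js) * (v $ (js ! p) * (\<Prod>q\<leftarrow>take p js @ drop (Suc p) js. x $ q))" for js
  have f: "f (take p js @ j # drop p js) =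
      A (i # take p js @ j # drop p js) * (\<Prod>q\<leftarrow>js. x $ q) * v $ j"
    if "length js = m - 2" for js j
  proof -
    have "length (take p js) = p" using that assms by simp
    then have "(take p js @ j # drop p js) ! p = j"
      "take p (take p js @ j # drop p js) @ drop (Suc p) (take p js @ j # drop p js) = js"
      by (simp_all add: nth_append)
    then show ?thesis unfolding f_def by (simp only: mult_ac)
  qed
  have "(partial_matrix m A x (p + 2) *v v) $ i =
      (\<Sum>j\<in>UNIV. \<Sum>js | length js = m - 2. f (take p js @ j # drop p js))"
    by (auto simp: partial_matrix_def matrix_vector_mult_def sum_distrib_right f intro!: sum.cong)
  also have "\<dots> = (\<Sum>js | length js = Suc (m - 2). f js)"
    by (rule sum_lists_insert_at[OF assms(1)])
  also have "Suc (m - 2) = m - 1" using assms by simp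
  finally show ?thesis by (simp add: f_def)
qed

lemma matrix_power_diag_matrix:
  "matrix_power (diag_matrix x) k = diag_matrix (vec_power x k)"
proof (induction k)
  case 0
  show ?case by (simp add: matrix_power_def diag_matrix_def vec_power_def mat_def vec_eq_iff)
next
  case (Suc k)
  have "matrix_power (diag_matrix x) (Suc k) = diag_matrix x ** matrix_power (diag_matrix x) k"
    by (simp add: matrix_power_def)
  also have "\<dots> = diag_matrix (vec_power x (Suc k))"
    by (simp only: Suc) (simp add: diag_matrix_def vec_power_def matrix_matrix_mult_def vec_eq_iff
        if_distrib [where f = "\<lambda>a. a * _"] cong: if_cong)
  finally show ?case .
qed

lemma diag_matrix_mult: "(diag_matrix x *v v) $ i = x $ i * v $ i"
  by (simp add: diag_matrix_def matrix_vector_mult_def if_distrib [where f = "\<lambda>a. a * _"] cong: if_cong)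

lemma sum_matrix_vector_mult:
  fixes B :: "'b \<Rightarrow> real^'n^'m"
  assumes "finite S"
  shows "(\<Sum>k\<in>S. B k) *v v = (\<Sum>k\<in>S. B k *v v)"
  using assms by induction (simp_all add: matrix_vector_mult_add_rdistrib)

text \<open>The inner sum over p is the derivative of a monomial in direction v. So M is the
  Jacobian at x of the map from x to l x^[m-1] - A x^(m-1).\<close>

lemma perron_matrix_mult:
  fixes A :: "(real, 'n::finite) tensor"
  assumes m: "m \<ge> 2"
  shows "(perron_matrix m A l x *v v) $ i = real (m - 1) * l * x $ i ^ (m - 2) * v $ i -
    (\<Sum>js | length js = m - 1. A (i # js) *
       (\<Sum>p<m - 1. v $ (js ! p) * (\<Prod>q\<leftarrow>take p js @ drop (Suc p) js. x $ q)))"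
proof -
  have "(\<Sum>k = 2..m. partial_matrix m A x k) = (\<Sum>p<m - 1. partial_matrix m A x (p + 2))"
    by (rule sum.reindex_bij_witness[of _ "\<lambda>p. p + 2" "\<lambda>k. k - 2"])
      (use m in \<open>auto simp del: add_2_eq_Suc'\<close>)
  then have "((\<Sum>k = 2..m. partial_matrix m A x k) *v v) $ i =
      (\<Sum>p<m - 1. (partial_matrix m A x (p + 2) *v v) $ i)"
    by (simp add: sum_matrix_vector_mult)
  also have "\<dots> = (\<Sum>p<m - 1. \<Sum>js | length js = m - 1.
       A (i # js) * (v $ (js ! p) * (\<Prod>q\<leftarrow>take p js @ drop (Suc p) js. x $ q)))"
    using m by (intro sum.cong refl partial_matrix_mult) auto
  also have "\<dots> = (\<Sum>js | length js = m - 1. A (i # js) *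
       (\<Sum>p<m - 1. v $ (js ! p) * (\<Prod>q\<leftarrow>take p js @ drop (Suc p) js. x $ q)))"
    by (subst sum.swap) (simp add: sum_distrib_left)
  finally show ?thesis
    by (simp add: perron_matrix_def matrix_vector_mult_diff_rdistrib matrix_power_diag_matrix
        diag_matrix_mult vec_power_def scaleR_matrix_vector_assoc [symmetric])
qed

text \<open>Euler's identity for homogeneous maps: for v = x each of the m - 1 summands is the full
  monomial, so M x is m - 1 times the defect of the eigenvalue equation.\<close>

lemma perron_matrix_null:
  fixes A :: "(real, 'n::finite) tensor"
  assumes m: "m \<ge> 2" and eig: "tensor_apply m A x = l *s vec_power x (m - 1)"
  shows "perron_matrix m A l x *v x = 0"
proof -
  have prod: "x $ (js ! p) * (\<Prod>q\<leftarrow>take p js @ drop (Suc p) js. x $ q) = (\<Prod>q\<leftarrow>js. x $ q)"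
    if "p < length js" for p and js :: "'n list"
    by (subst (3) id_take_nth_drop[OF that]) (simp add: mult_ac)
  have "(perron_matrix m A l x *v x) $ i = 0" for i
  proof -
    have "(\<Sum>js | length js = m - 1. A (i # js) *
          (\<Sum>p<m - 1. x $ (js ! p) * (\<Prod>q\<leftarrow>take p js @ drop (Suc p) js. x $ q))) =
        (\<Sum>js | length js = m - 1. A (i # js) * (real (m - 1) * (\<Prod>q\<leftarrow>js. x $ q)))"
    proof (intro sum.cong refl arg_cong2[of _ _ _ _ "(*)"])
      fix js :: "'n list" assume "js \<in> {js. length js = m - 1}"
      then have "(\<Sum>p<m - 1. x $ (js ! p) * (\<Prod>q\<leftarrow>take p js @ drop (Suc p) js. x $ q)) =
          (\<Sum>p<m - 1. \<Prod>q\<leftarrow>js. x $ q)"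
        by (intro sum.cong refl prod) auto
      then show "(\<Sum>p<m - 1. x $ (js ! p) * (\<Prod>q\<leftarrow>take p js @ drop (Suc p) js. x $ q)) =
          real (m - 1) * (\<Prod>q\<leftarrow>js. x $ q)" by simp
    qed
    also have "\<dots> = real (m - 1) * tensor_apply m A x $ i"
      by (simp add: tensor_apply_def sum_distrib_left mult_ac)
    also have "\<dots> = real (m - 1) * l * x $ i ^ (m - 1)"
      by (simp add: eig vec_power_def)
    also have "x $ i ^ (m - 1) = x $ i ^ (m - 2) * x $ i"
      using m by (metis Suc_1 Suc_diff_le diff_Suc_Suc power_Suc2)
    finally show ?thesis unfolding perron_matrix_mult[OF m] by simp
  qed
  then show ?thesis by (simp add: vec_eq_iff)
qed

section \<open>Sign pattern, irreducibility and symmetry of M\<close>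

lemma perron_matrix_off_diag:
  "i \<noteq> j \<Longrightarrow> perron_matrix m A l x $ i $ j = - (\<Sum>k = 2..m. partial_matrix m A x k $ i $ j)"
  unfolding perron_matrix_def matrix_power_diag_matrix by (simp add: diag_matrix_def)

lemma partial_matrix_nonneg:
  fixes A :: "(real, 'n::finite) tensor"
  assumes A: "nonneg_tensor m A" and x: "pos_vec x" and k: "2 \<le> k" "k \<le> m"
  shows "partial_matrix m A x k $ i $ j \<ge> 0"
  unfolding partial_matrix_def vec_lambda_beta
proof (intro sum_nonneg mult_nonneg_nonneg)
  fix js :: "'n list" assume "js \<in> {js. length js = m - 2}"
  then show "0 \<le> A (i # take (k - 2) js @ j # drop (k - 2) js)"
    using A k by (auto simp: nonneg_tensor_def)
  show "0 \<le> (\<Prod>p\<leftarrow>js. x $ p)"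
    using x by (intro prod_list_nonneg) (auto simp: pos_vec_def less_imp_le)
qed

lemma Z_matrix_perron_matrix:
  fixes A :: "(real, 'n::finite) tensor"
  assumes "nonneg_tensor m A" "pos_vec x"
  shows "Z_matrix (perron_matrix m A l x)"
  unfolding Z_matrix_def
proof (intro allI impI)
  fix i j :: 'n assume "i \<noteq> j"
  then show "perron_matrix m A l x $ i $ j \<le> 0"
    using assms by (auto simp: perron_matrix_off_diag intro!: sum_nonneg partial_matrix_nonneg)
qed

text \<open>An entry witnessing a tensor arc (i, j) with i and j distinct adds a positive term to
  some \<open>partial_matrix\<close> at (i, j). All other terms are nonnegative, so nothing
  cancels.\<close>

lemma irreducible_perron_matrix:
  fixes A :: "(real, 'n::finite) tensor"
  assumes m: "m \<ge> 2" and A: "nonneg_tensor m A" and irr: "weakly_irreducible m A" and x: "pos_vec x"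
  shows "irreducible_matrix (perron_matrix m A l x)"
proof -
  let ?E = "{(i, j). i \<noteq> j \<and> perron_matrix m A l x $ i $ j \<noteq> 0}"
  have "(i, j) \<in> ?E\<^sup>*" if arc: "(i, j) \<in> tensor_arcs m A" for i j
  \<comment> \<open>The tensor digraph may contain loops, which the reflexive closure
    absorbs.\<close>
  proof (cases "i = j")
    case False
    obtain js where js: "length js = m - 1" "A (i # js) \<noteq> 0" "j \<in> set js"
      using arc by (auto simp: tensor_arcs_def)
    obtain p where p: "p < m - 1" "js ! p = j" using js(1,3) by (metis in_set_conv_nth)
    define ks where "ks = take p js @ drop (Suc p) js"
    have ks: "length ks = m - 2" "take p ks @ j # drop p ks = js"
      using js(1) p by (auto simp: ks_def min_def id_take_nth_drop[symmetric])
    have nn: "0 \<le> A (i # take p ls @ j # drop p ls) * (\<Prod>q\<leftarrow>ls. x $ q)"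
      if "length ls = m - 2" for ls
      using A x p that m
      by (intro mult_nonneg_nonneg prod_list_nonneg) (auto simp: nonneg_tensor_def pos_vec_def less_imp_le)
    have "A (i # js) > 0" using js(1,2) A m by (metis nonneg_tensorD order_le_less)
    moreover have "(\<Prod>q\<leftarrow>ks. x $ q) > 0" using x by (simp add: prod_list_pos pos_vec_def)
    ultimately have "0 < A (i # take p ks @ j # drop p ks) * (\<Prod>q\<leftarrow>ks. x $ q)" by (simp add: ks(2))
    also have "\<dots> \<le> partial_matrix m A x (p + 2) $ i $ j"
      unfolding partial_matrix_def vec_lambda_beta add_diff_cancel_right'
      by (rule member_le_sum[where f = "\<lambda>ls. A (i # take p ls @ j # drop p ls) * (\<Prod>q\<leftarrow>ls. x $ q)"])
        (use ks(1) nn in auto)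
    also have "\<dots> \<le> (\<Sum>k = 2..m. partial_matrix m A x k $ i $ j)"
      using p m A x
      by (intro member_le_sum[of _ _ "\<lambda>k. partial_matrix m A x k $ i $ j"]) (auto intro: partial_matrix_nonneg)
    finally have "perron_matrix m A l x $ i $ j \<noteq> 0" using False by (simp add: perron_matrix_off_diag)
    with False show ?thesis by blast
  qed simp
  then have "(tensor_arcs m A)\<^sup>* \<subseteq> ?E\<^sup>*" by (intro rtrancl_subset_rtrancl) auto
  with irr show ?thesis
    unfolding irreducible_matrix_def weakly_irreducible_def strongly_connected_def by blast
qed

lemma symmetric_tensor_mset_eq:
  assumes "symmetric_tensor m A" "mset xs = mset ys" "length xs = m"
  shows "A xs = A ys"
proof -
  obtain p where "p permutes {..<length ys}" "permute_list p ys = xs"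
    using mset_eq_permutation[OF assms(2)] by blast
  moreover have "length ys = m" using assms(2,3) by (metis size_mset)
  ultimately show ?thesis using assms(1) by (auto simp: symmetric_tensor_def)
qed

text \<open>Exchanging i and j only rearranges the index list of each entry. In the symmetric case
  the right null vector is therefore also a left null vector.\<close>

lemma perron_matrix_symmetric:
  fixes A :: "(real, 'n::finite) tensor"
  assumes "symmetric_tensor m A"
  shows "transpose (perron_matrix m A l x) = perron_matrix m A l x"
proof -
  have partial: "partial_matrix m A x k $ i $ j = partial_matrix m A x k $ j $ i" if "k \<in> {2..m}" for k i j
    unfolding partial_matrix_def vec_lambda_beta
  proof (intro sum.cong refl arg_cong2[of _ _ _ _ "(*)"] symmetric_tensor_mset_eq[OF assms])
    fix js :: "'n list" assume "js \<in> {js. length js = m - 2}"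
    then show "length (i # take (k - 2) js @ j # drop (k - 2) js) = m" using that by auto
  qed auto
  have "perron_matrix m A l x $ i $ j = perron_matrix m A l x $ j $ i" for i j
    by (cases "i = j") (auto simp: perron_matrix_off_diag intro!: sum.cong partial)
  then show ?thesis by (simp add: transpose_def vec_eq_iff)
qed

section \<open>Dual eigenpairs\<close>

lemma dual_simps [simp]:
  "std_part 0 = 0" "eps_part 0 = 0" "std_part 1 = 1" "eps_part 1 = 0"
  "std_part (a + b) = std_part a + std_part b" "eps_part (a + b) = eps_part a + eps_part b"
  "std_part (a * b) = std_part a * std_part b"
  "eps_part (a * b) = std_part a * eps_part b + eps_part a * std_part b"
  by (simp_all add: zero_dual_num_def one_dual_num_def plus_dual_num_def times_dual_num_def)

lemma dual_num_eq_iff: "a = b \<longleftrightarrow> std_part a = std_part b \<and> eps_part a = eps_part b"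
  by (auto intro: dual_num.expand)

lemma std_part_sum: "std_part (\<Sum>i\<in>S. f i) = (\<Sum>i\<in>S. std_part (f i))"
  by (induction S rule: infinite_finite_induct) auto

lemma eps_part_sum: "eps_part (\<Sum>i\<in>S. f i) = (\<Sum>i\<in>S. eps_part (f i))"
  by (induction S rule: infinite_finite_induct) auto

lemma std_part_power: "std_part (a ^ k) = std_part a ^ k"
  by (induction k) auto

text \<open>The dual part obeys the product rule. For k = 0 the truncated exponent is harmless
  because the factor \<open>real k\<close> vanishes.\<close>

lemma eps_part_power: "eps_part (a ^ k) = real k * std_part a ^ (k - 1) * eps_part a"
proof (induction k)
  case (Suc k)
  then show ?case by (cases k) (simp_all add: std_part_power algebra_simps)
qed simp

lemma std_part_prod_list: "std_part (\<Prod>j\<leftarrow>js. f j) = (\<Prod>j\<leftarrow>js. std_part (f j))"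
  by (induction js) auto

text \<open>Leibniz rule, written with the same sum over positions as in
  \<open>perron_matrix_mult\<close> so that the two can be matched.\<close>

lemma eps_part_prod_list:
  "eps_part (\<Prod>j\<leftarrow>js. f j) =
    (\<Sum>p<length js. eps_part (f (js ! p)) * (\<Prod>q\<leftarrow>take p js @ drop (Suc p) js. std_part (f q)))"
proof (induction js)
  case (Cons a js)
  then show ?case
    by (simp add: sum.lessThan_Suc_shift std_part_prod_list sum_distrib_left mult_ac del: sum.lessThan_Suc)
qed simp

text \<open>In row i the identity tensor is nonzero only at the tail consisting of m - 1 copies of
  i.\<close>

lemma tensor_apply_shift_id:
  fixes B :: "(real, 'n::finite) tensor"
  assumes "m \<ge> 2"
  shows "tensor_apply m (\<lambda>is. B is - c * id_tensor m is) x = tensor_apply m B x - c *s vec_power x (m - 1)"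
proof -
  have "id_tensor m (i # js) * (\<Prod>j\<leftarrow>js. x $ j) =
      (if js = replicate (m - 1) i then x $ i ^ (m - 1) else 0)"
    if "length js = m - 1" for i js
  proof -
    have "(\<exists>k. i # js = replicate m k) \<longleftrightarrow> js = replicate (m - 1) i"
      using assms by (cases m) auto
    then show ?thesis by (auto simp: id_tensor_def map_replicate)
  qed
  then have "(\<Sum>js | length js = m - 1. id_tensor m (i # js) * (\<Prod>j\<leftarrow>js. x $ j)) =
      (\<Sum>js | length js = m - 1. if js = replicate (m - 1) i then x $ i ^ (m - 1) else 0)" for i
    by (intro sum.cong) auto
  then have id: "(\<Sum>js | length js = m - 1. id_tensor m (i # js) * (\<Prod>j\<leftarrow>js. x $ j)) = x $ i ^ (m - 1)" for i
    by (simp del: One_nat_def)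
  have "tensor_apply m (\<lambda>is. B is - c * id_tensor m is) x $ i =
      tensor_apply m B x $ i -
        c * (\<Sum>js | length js = m - 1. id_tensor m (i # js) * (\<Prod>j\<leftarrow>js. x $ j))" for i
    by (simp add: tensor_apply_def left_diff_distrib sum_subtractf sum_distrib_left mult.assoc)
  then show ?thesis by (simp add: vec_eq_iff id vec_power_def del: One_nat_def)
qed

text \<open>The dual part of the eigenvalue equation is the linearisation of the standard part.\<close>
lemma dual_eigenpair_iff:
  fixes A :: "(dual_num, 'n::finite) tensor"
  assumes m: "m \<ge> 2"
  shows "dual_eigenpair m A l x \<longleftrightarrow> std_vec x \<noteq> 0 \<and>
    tensor_apply m (\<lambda>is. std_part (A is)) (std_vec x) = std_part l *s vec_power (std_vec x) (m - 1) \<and>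
    perron_matrix m (\<lambda>is. std_part (A is)) (std_part l) (std_vec x) *v eps_vec x =
      tensor_apply m (\<lambda>is. eps_part (A is) - eps_part l * id_tensor m is) (std_vec x)"
    (is "_ \<longleftrightarrow> _ \<and> ?std \<and> ?eps")
proof -
  have m': "m - 1 - 1 = m - 2" by simp
  have s1: "std_part (tensor_apply m A x $ i) = tensor_apply m (\<lambda>is. std_part (A is)) (std_vec x) $ i" for i
    by (simp add: tensor_apply_def std_part_sum std_part_prod_list std_vec_def)
  have s2: "std_part ((l *s vec_power x (m - 1)) $ i) =
      (std_part l *s vec_power (std_vec x) (m - 1)) $ i" for i
    by (simp add: vec_power_def std_part_power std_vec_def)
  have e1: "eps_part (tensor_apply m A x $ i) =
      tensor_apply m (\<lambda>is. eps_part (A is)) (std_vec x) $ i +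
      (\<Sum>js | length js = m - 1. std_part (A (i # js)) *
       (\<Sum>p<m - 1. eps_vec x $ (js ! p) * (\<Prod>q\<leftarrow>take p js @ drop (Suc p) js. std_vec x $ q)))" for i
    by (auto simp: tensor_apply_def eps_part_sum std_part_prod_list eps_part_prod_list std_vec_def
        eps_vec_def sum.distrib intro!: sum.cong)
  have e2: "eps_part ((l *s vec_power x (m - 1)) $ i) =
      real (m - 1) * std_part l * std_vec x $ i ^ (m - 2) * eps_vec x $ i +
      eps_part l * std_vec x $ i ^ (m - 1)" for i
    by (simp add: vec_power_def std_part_power eps_part_power std_vec_def eps_vec_def m' del: One_nat_def)
  \<comment> \<open>Moves the derivative of the tensor map to the left, where it completes M, and
    the term with the dual part of the eigenvalue to the right.\<close>
  have lin: "a + b = c + d \<longleftrightarrow> c - b = a - d" for a b c d :: real by auto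
  have "tensor_apply m A x = l *s vec_power x (m - 1) \<longleftrightarrow> ?std \<and> ?eps"
    unfolding tensor_apply_shift_id[OF m] vec_eq_iff dual_num_eq_iff s1 s2 e1 e2
      perron_matrix_mult[OF m] all_conj_distrib lin
    by (simp add: vec_power_def)
  then show ?thesis by (simp add: dual_eigenpair_def)
qed

text \<open>The group inverse formula appears in two forms. As y^T G = 0, writing x_d = G b + c x_s
  gives y . x_d = c (y . x_s), so for an arbitrary pair orthogonality to y is what forces c = 0. The
  form with x_s . x_d = 0 is asserted for the constructed pair. In the symmetric case y is parallel
  to x_s and the two conditions agree.\<close>

theorem theorem3p2:
  fixes A :: "(dual_num, 'n::finite) tensor"
    and m :: nat
  assumes "m \<ge> 2"
    and "nonneg_tensor m (\<lambda>is. std_part (A is))"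
    and "weakly_irreducible m (\<lambda>is. std_part (A is))"
  shows "let As = (\<lambda>is. std_part (A is)); Ad = (\<lambda>is. eps_part (A is)) in
    (\<exists>l x. dual_pos l \<and> dual_pos_vec x \<and> dual_eigenpair m A l x \<and>
       (let ls = std_part l; ld = eps_part l; xs = std_vec x; xd = eps_vec x;
            M = perron_matrix m As ls xs;
            b = tensor_apply m (\<lambda>is. Ad is - ld * id_tensor m is) xs
        in \<exists>G. is_group_inverse M G \<and> (xs \<bullet> xd = 0 \<longrightarrow> xd = G *v b))) \<and>
    (\<forall>l x. dual_pos l \<and> dual_pos_vec x \<and> dual_eigenpair m A l x \<longrightarrow>
       (let ls = std_part l; ld = eps_part l; xs = std_vec x; xd = eps_vec x;
            M = perron_matrix m As ls xs;
            b = tensor_apply m (\<lambda>is. Ad is - ld * id_tensor m is) xs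
        in
          (is_spectral_radius (tensor_eigenvalues m (\<lambda>is. complex_of_real (As is))) ls \<and>
           tensor_apply m As xs = ls *s vec_power xs (m - 1)) \<and>
          (irreducible_matrix M \<and> det M = 0 \<and> M_matrix M \<and>
           matrix_ker M = {c *\<^sub>R xs | c. True} \<and>
           (\<exists>!y. pos_unit_left_null M y) \<and>
           (\<forall>y. pos_unit_left_null M y \<longrightarrow>
              ld = (y \<bullet> tensor_apply m Ad xs) / (y \<bullet> vec_power xs (m - 1)) \<and>
              (symmetric_tensor m As \<longrightarrow> y = (1 / sqrt (xs \<bullet> xs)) *\<^sub>R xs))) \<and>
          (\<forall>M1. is_one_inverse M M1 \<longrightarrow>
             (let S = {M1 *v b + c *\<^sub>R xs | c. True} in
                xd \<in> S \<and> (\<forall>z\<in>S. dual_eigenpair m A l (dual_vec xs z)))) \<and>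
          (\<exists>G. is_group_inverse M G \<and>
             (\<forall>y. pos_unit_left_null M y \<and> y \<bullet> xd = 0 \<longrightarrow> xd = G *v b))))"
proof -
  let ?As = "\<lambda>is. std_part (A is)" and ?Ad = "\<lambda>is. eps_part (A is)"
  note m = assms(1) and A = assms(2) and irr = assms(3)
  let ?M = "\<lambda>l x. perron_matrix m ?As (std_part l) (std_vec x)"
  let ?b = "\<lambda>l x. tensor_apply m (\<lambda>is. ?Ad is - eps_part l * id_tensor m is) (std_vec x)"

  have ker: "Z_matrix (perron_matrix m ?As l x)" "irreducible_matrix (perron_matrix m ?As l x)"
    "perron_matrix m ?As l x *v x = 0"
    if "pos_vec x" "tensor_apply m ?As x = l *s vec_power x (m - 1)" for l x
    using that Z_matrix_perron_matrix[OF A] irreducible_perron_matrix[OF m A irr] perron_matrix_null[OF m]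
    by auto

  obtain t x0 where t: "t > 0" and x0: "pos_vec x0"
    and eig0: "tensor_apply m ?As x0 = t *s vec_power x0 (m - 1)"
    using weakly_irreducible_pos_eigenvector[OF m A irr] .
  note M0 = ker[OF x0 eig0]
  let ?K = "perron_matrix m ?As t x0"
  obtain y0 where y0: "pos_vec y0" "y0 v* ?K = 0"
    using Z_matrix_pos_left_null[OF M0(1,2) x0 M0(3)] .
  have "y0 \<bullet> x0 \<noteq> 0" using pos_vec_inner_pos[OF y0(1) x0] by simp
  then obtain G0 where G0: "is_group_inverse ?K G0" "\<And>b. y0 \<bullet> b = 0 \<Longrightarrow> ?K *v (G0 *v b) = b"
    using group_inverse_simple_kernel[OF M0(3) y0(2) _ Z_matrix_ker[OF M0(1,2) x0 M0(3)]] by metis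
  have vp: "pos_vec (vec_power v k)" if "pos_vec v" for v :: "real^'n" and k
    using that by (simp add: pos_vec_def vec_power_def)
  \<comment> \<open>The value of the dual part of the eigenvalue for which the right-hand side
    \<open>b0\<close> is orthogonal to \<open>y0\<close>, hence in the range of the matrix.\<close>
  define d where "d = (y0 \<bullet> tensor_apply m ?Ad x0) / (y0 \<bullet> vec_power x0 (m - 1))"
  define b0 where "b0 = tensor_apply m (\<lambda>is. ?Ad is - d * id_tensor m is) x0"
  have "y0 \<bullet> b0 = 0"
    using pos_vec_inner_pos[OF y0(1) vp[OF x0, of "m - 1"]]
    unfolding b0_def tensor_apply_shift_id[OF m]
    by (simp add: inner_diff_right d_def scalar_mult_eq_scaleR)
  then have b0: "?K *v (G0 *v b0) = b0" by (rule G0(2))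
  define l0 where "l0 = Dual t d"
  \<comment> \<open>Among all solutions, which differ by multiples of \<open>x0\<close>, this one
    satisfies the group inverse formula by construction.\<close>
  define z0 where "z0 = dual_vec x0 (G0 *v b0)"
  have z0: "std_vec z0 = x0" "eps_vec z0 = G0 *v b0"
    by (simp_all add: z0_def dual_vec_def std_vec_def eps_vec_def vec_eq_iff)
  have "dual_pos l0 \<and> dual_pos_vec z0 \<and> dual_eigenpair m A l0 z0"
    using t x0 eig0 b0 pos_vec_nonzero[OF x0]
    by (simp add: dual_eigenpair_iff[OF m] z0 l0_def dual_pos_def dual_pos_vec_def b0_def del: One_nat_def)
  moreover have "is_group_inverse (?M l0 z0) G0" "eps_vec z0 = G0 *v ?b l0 z0"
    using G0(1) by (simp_all add: z0 l0_def b0_def)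
  ultimately have existence: "\<exists>l x. dual_pos l \<and> dual_pos_vec x \<and> dual_eigenpair m A l x \<and>
      (\<exists>G. is_group_inverse (?M l x) G \<and> (std_vec x \<bullet> eps_vec x = 0 \<longrightarrow> eps_vec x = G *v ?b l x))"
    by blast

  \<comment> \<open>The abbreviations enter as variables with defining equations, which reflexivity
    discharges once the lets of the goal are unfolded.\<close>
  have main: "(is_spectral_radius (tensor_eigenvalues m (\<lambda>is. complex_of_real (?As is))) ls \<and>
        tensor_apply m ?As xs = ls *s vec_power xs (m - 1)) \<and>
      (irreducible_matrix M \<and> det M = 0 \<and> M_matrix M \<and>
       matrix_ker M = {c *\<^sub>R xs | c. True} \<and>
       (\<exists>!y. pos_unit_left_null M y) \<and>
       (\<forall>y. pos_unit_left_null M y \<longrightarrow>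
          ld = (y \<bullet> tensor_apply m ?Ad xs) / (y \<bullet> vec_power xs (m - 1)) \<and>
          (symmetric_tensor m ?As \<longrightarrow> y = (1 / sqrt (xs \<bullet> xs)) *\<^sub>R xs))) \<and>
      (\<forall>M1. is_one_inverse M M1 \<longrightarrow>
         xd \<in> {M1 *v b + c *\<^sub>R xs | c. True} \<and>
         (\<forall>z\<in>{M1 *v b + c *\<^sub>R xs | c. True}. dual_eigenpair m A l (dual_vec xs z))) \<and>
      (\<exists>G. is_group_inverse M G \<and>
         (\<forall>y. pos_unit_left_null M y \<and> y \<bullet> xd = 0 \<longrightarrow> xd = G *v b))"
    if lx: "dual_pos l" "dual_pos_vec x" "dual_eigenpair m A l x"
      and defs: "ls = std_part l" "ld = eps_part l" "xs = std_vec x" "xd = eps_vec x"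
        "M = perron_matrix m ?As ls xs" "b = tensor_apply m (\<lambda>is. ?Ad is - ld * id_tensor m is) xs"
    for l x ls ld xs xd M b
  proof -
    have ls: "ls > 0" and xs: "pos_vec xs" using lx(1,2) by (simp_all add: defs dual_pos_def dual_pos_vec_def)
    have eig: "tensor_apply m ?As xs = ls *s vec_power xs (m - 1)" and Mxd: "M *v xd = b"
      using lx(3) by (simp_all add: dual_eigenpair_iff[OF m] defs del: One_nat_def)
    note M = ker[OF xs eig, folded defs(5)]
    note kerM = Z_matrix_ker[OF M(1,2) xs M(3)]
    note unique = Z_matrix_unique_pos_unit_left_null[OF M(1,2) xs M(3)]
    have left: "ld = (y \<bullet> tensor_apply m ?Ad xs) / (y \<bullet> vec_power xs (m - 1))"
      if "pos_unit_left_null M y" for y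
    proof -
      \<comment> \<open>Pairing M x_d = b with the left null vector y leaves an equation that
        determines the dual part of the eigenvalue.\<close>
      have "y \<bullet> b = 0"
        using that dot_lmul_matrix[of y M xd] by (simp add: Mxd pos_unit_left_null_def)
      then show ?thesis
        using pos_vec_inner_pos[OF _ vp[OF xs, of "m - 1"], of y] that
        by (simp add: defs(6) tensor_apply_shift_id[OF m] inner_diff_right scalar_mult_eq_scaleR
            pos_unit_left_null_def field_simps del: One_nat_def)
    qed
    have sym: "y = (1 / sqrt (xs \<bullet> xs)) *\<^sub>R xs"
      if "pos_unit_left_null M y" "symmetric_tensor m ?As" for y
    proof -
      have "transpose M = M" using perron_matrix_symmetric[OF that(2)] by (simp add: defs(5))
      then have "xs v* M = 0" using M(3) by (metis transpose_matrix_vector)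
      moreover have "norm xs > 0" using pos_vec_nonzero[OF xs] by simp
      ultimately have "pos_unit_left_null M ((1 / norm xs) *\<^sub>R xs)"
        using xs scaleR_vector_matrix_assoc[of "1 / norm xs" xs M]
        by (auto simp: pos_unit_left_null_def pos_vec_def)
      then show ?thesis using unique that(1) by (auto simp: norm_eq_sqrt_inner)
    qed
    obtain y where y: "pos_unit_left_null M y" using unique by blast
    then have "y \<bullet> xs \<noteq> 0" "y v* M = 0"
      using pos_vec_inner_pos[OF _ xs, of y] by (auto simp: pos_unit_left_null_def)
    then obtain G where G: "is_group_inverse M G" "\<And>v b. M *v v = b \<Longrightarrow> y \<bullet> v = 0 \<Longrightarrow> v = G *v b"
      using group_inverse_simple_kernel[OF M(3) _ _ kerM] by metis
    have "\<exists>G. is_group_inverse M G \<and>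
        (\<forall>y. pos_unit_left_null M y \<and> y \<bullet> xd = 0 \<longrightarrow> xd = G *v b)"
      using G(1) G(2)[OF Mxd] y unique by blast
    moreover have "xd \<in> {M1 *v b + c *\<^sub>R xs | c. True} \<and>
        (\<forall>z\<in>{M1 *v b + c *\<^sub>R xs | c. True}. dual_eigenpair m A l (dual_vec xs z))"
      if "is_one_inverse M M1" for M1
    proof -
      \<comment> \<open>Since b = M x_d lies in the range of M, the identity M M1 M = M makes M1 b a
        particular solution.\<close>
      have MM1b: "M *v (M1 *v b) = b"
        using that by (simp add: is_one_inverse_def matrix_vector_mul_assoc matrix_mul_assoc flip: Mxd)
      have "xd - M1 *v b \<in> matrix_ker M"
        by (simp add: matrix_ker_def matrix_vector_mult_diff_distrib Mxd MM1b)
      then obtain c where "xd - M1 *v b = c *\<^sub>R xs" unfolding kerM by blast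
      then have "xd = M1 *v b + c *\<^sub>R xs" by (simp add: algebra_simps)
      moreover have "dual_eigenpair m A l (dual_vec xs (M1 *v b + c *\<^sub>R xs))" for c
      proof -
        have "std_vec (dual_vec xs v) = xs" "eps_vec (dual_vec xs v) = v" for v
          by (simp_all add: dual_vec_def std_vec_def eps_vec_def vec_eq_iff)
        moreover have "M *v (M1 *v b + c *\<^sub>R xs) = b"
          by (simp add: matrix_vector_right_distrib matrix_vector_mult_scaleR M(3) MM1b)
        ultimately show ?thesis
          using eig pos_vec_nonzero[OF xs] by (simp add: dual_eigenpair_iff[OF m] defs(1,2,5,6) del: One_nat_def)
      qed
      ultimately show ?thesis by blast
    qed
    moreover have "det M = 0" by (rule null_vector_det_0[OF M(3) pos_vec_nonzero[OF xs]])
    ultimately show ?thesis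
      using tensor_spectral_radius[OF m A xs eig] ls eig M(2) Z_matrix_M_matrix[OF M(1) xs M(3)]
        kerM unique left sym
      by auto
  qed
  show ?thesis
    unfolding Let_def
    by (intro conjI[OF existence] allI impI; elim conjE;
        rule main[OF _ _ _ refl refl refl refl refl refl]; assumption)
qed

end
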